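(* Let $\mu\in M_+(\mathbb D^-)$, let $b\in H^\infty_1$ be $\mu$-admissible, and let $h=d(\mu|\mathbb T)/dm$. If $\mu$ is a reverse Carleson measure for $\mathscr H(b)$, then there is a constant $C>0$ such that $$1-|b|^2\le C\,(1-|b|^2)^2h\qquad m\text{-almost everywhere on }\mathbb T.$$
   Context: $\mathbb D$ is the open unit disk, $\mathbb D^-$ its closure, $\mathbb T=\partial\mathbb D$, $m$ normalized Lebesgue measure on $\mathbb T$. $H^\infty_1$ is the closed unit ball of $H^\infty$ (bounded analytic functions on $\mathbb D$ with sup norm). For $b\in H^\infty_1$, the de Branges–Rovnyak space $\mathscr H(b)$ is the reproducing kernel Hilbert space of analytic functions on $\mathbb D$ with reproducing kernel $k^b_\lambda(z)=\frac{1-\overline{b(\lambda)}b(z)}{1-\overline\lambda z}$ ($\lambda,z\in\mathbb D$); its norm is denoted $\|\cdot\|_b$. It is contractively contained in $H^2$. $M_+(\mathbb D^-)$ is the set of positive finite Borel measures on $\mathbb D^-$. For $\mu\in M_+(\mathbb D^-)$, an analytic function $f$ on $\mathbb D$ is $\mu$-admissible if its non-tangential limits exist $\mu$-almost everywhere on $\mathbb T$; such an $f$ is extended $\mu$-a.e. to $\mathbb T$ by its non-tangential limits, and $\|f\|_\mu\in[0,+\infty]$ denotes its $L^2(\mu)$ norm. $\mathscr H(b)_\mu$ is the set of $\mu$-admissible functions in $\mathscr H(b)$. The measure $\mu$ is a reverse Carleson measure for $\mathscr H(b)$ if $\mathscr H(b)_\mu$ is dense in $\mathscr H(b)$ and there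 is a constant $C>0$ with $\|f\|_b\le C\|f\|_\mu$ for all $f\in\mathscr H(b)_\mu$. $d(\mu|\mathbb T)/dm$ is the Radon–Nikodym derivative of the absolutely continuous part (with respect to $m$) of the restriction of $\mu$ to $\mathbb T$. On $\mathbb T$, $b$ denotes its non-tangential boundary function. *)

theory Defs
  imports "HOL-Probability.Probability"
begin

abbreviation unit_disk :: "complex set" where
  "unit_disk \<equiv> ball 0 1"

abbreviation unit_circle :: "complex set" where
  "unit_circle \<equiv> sphere 0 1"

definition circle_measure :: "complex measure" where
  "circle_measure =
     distr (uniform_measure lborel {0..<2 * pi}) (restrict_space borel unit_circle) cis"

lemma sets_circle_measure: "sets circle_measure = sets (restrict_space borel unit_circle)"
  by (simp add: circle_measure_def)

lemma emeasure_circle_measure_space: "emeasure circle_measure (space circle_measure) = 1"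
proof -
  have "cis \<in> borel_measurable borel"
    by (intro borel_measurable_continuous_onI continuous_intros)
  then have "cis \<in> measurable (uniform_measure lborel {0..<2 * pi}) (restrict_space borel unit_circle)"
    by (intro measurable_restrict_space2) (auto simp: measurable_def)
  moreover have "prob_space (uniform_measure lborel {0..<2 * pi})"
    by (rule prob_space_uniform_measure) auto
  ultimately show ?thesis
    unfolding circle_measure_def by (intro prob_space.emeasure_space_1 prob_space.prob_space_distr)
qed

definition Hinf_unit_ball :: "(complex \<Rightarrow> complex) set" where
  "Hinf_unit_ball = {f. f holomorphic_on unit_disk \<and> (\<forall>z\<in>unit_disk. norm (f z) \<le> 1)}"


text \<open>Non-tangential limits are limits within every Stolz angle.\<close>

definition stolz_angle :: "real \<Rightarrow> complex \<Rightarrow> complex set" where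
  "stolz_angle a \<zeta> = {z \<in> unit_disk. dist z \<zeta> < a * (1 - norm z)}"

definition nt_limit :: "(complex \<Rightarrow> complex) \<Rightarrow> complex \<Rightarrow> complex \<Rightarrow> bool" where
  "nt_limit f \<zeta> L \<longleftrightarrow> (\<forall>a>1. (f \<longlongrightarrow> L) (at \<zeta> within stolz_angle a \<zeta>))"

text \<open>The extension of a function on the disk by its non-tangential limits. The value 0 at points
  of the circle where there is no such limit is a dummy: these points form a null set for the
  measure \<open>\<mu>\<close> if the function is \<open>\<mu>\<close>-admissible, and for the Lebesgue measure if it is bounded
  (Fatou's theorem).\<close>

definition nt_ext :: "(complex \<Rightarrow> complex) \<Rightarrow> complex \<Rightarrow> complex" where
  "nt_ext f z =
     (if z \<in> unit_disk then f z
      else if z \<in> unit_circle \<and> (\<exists>L. nt_limit f z L) then (THE L. nt_limit f z L)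
      else 0)"


definition finite_borel_measure_on_closed_disk :: "complex measure \<Rightarrow> bool" where
  "finite_borel_measure_on_closed_disk \<mu> \<longleftrightarrow>
     sets \<mu> = sets (restrict_space borel (cball 0 1)) \<and> finite_measure \<mu>"

lemma sets_restrict_circle:
  assumes "finite_borel_measure_on_closed_disk \<mu>"
  shows "sets (restrict_space \<mu> unit_circle) = sets circle_measure"
proof -
  have "cball (0::complex) 1 \<inter> unit_circle = unit_circle" by auto
  then show ?thesis
    using assms unfolding finite_borel_measure_on_closed_disk_def sets_circle_measure
    by (simp add: sets_restrict_space_cong[of \<mu> "restrict_space borel (cball 0 1)"]
        sets_restrict_restrict_space)
qed

definition admissible :: "complex measure \<Rightarrow> (complex \<Rightarrow> complex) \<Rightarrow> bool" where
  "admissible \<mu> f \<longleftrightarrow> f holomorphic_on unit_disk \<and>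
     (AE \<zeta> in \<mu>. \<zeta> \<in> unit_circle \<longrightarrow> (\<exists>L. nt_limit f \<zeta> L))"

definition L2_norm :: "complex measure \<Rightarrow> (complex \<Rightarrow> complex) \<Rightarrow> ennreal" where
  "L2_norm \<mu> f =
     (let I = (\<integral>\<^sup>+ z. ennreal ((norm (nt_ext f z))\<^sup>2) \<partial>\<mu>)
      in if I = \<infinity> then \<infinity> else ennreal (sqrt (enn2real I)))"


text \<open>Functions on a set \<open>S\<close> are represented by functions vanishing off \<open>S\<close>. The pair \<open>H\<close>, \<open>ip\<close>
  (linear in the first argument) is a reproducing kernel Hilbert space of functions on \<open>S\<close> with
  kernel \<open>K\<close>, where \<open>K w\<close> is the kernel function at the point \<open>w\<close>. By the Moore-Aronszajn theorem
  \<open>S\<close> and \<open>K\<close> determine \<open>H\<close>, and \<open>ip\<close> on \<open>H\<close>.\<close>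

definition hnorm :: "((complex \<Rightarrow> complex) \<Rightarrow> (complex \<Rightarrow> complex) \<Rightarrow> complex) \<Rightarrow>
    (complex \<Rightarrow> complex) \<Rightarrow> real" where
  "hnorm ip f = sqrt (Re (ip f f))"

locale rkhs =
  fixes S :: "complex set"
    and K :: "complex \<Rightarrow> complex \<Rightarrow> complex"
    and H :: "(complex \<Rightarrow> complex) set"
    and ip :: "(complex \<Rightarrow> complex) \<Rightarrow> (complex \<Rightarrow> complex) \<Rightarrow> complex"
  assumes vanish_off: "\<And>f z. f \<in> H \<Longrightarrow> z \<notin> S \<Longrightarrow> f z = 0"
    and zero_mem: "(\<lambda>_. 0) \<in> H"
    and add_mem: "\<And>f g. f \<in> H \<Longrightarrow> g \<in> H \<Longrightarrow> (\<lambda>z. f z + g z) \<in> H"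
    and scale_mem: "\<And>c f. f \<in> H \<Longrightarrow> (\<lambda>z. c * f z) \<in> H"
    and ip_add: "\<And>f g h. f \<in> H \<Longrightarrow> g \<in> H \<Longrightarrow> h \<in> H \<Longrightarrow>
                   ip (\<lambda>z. f z + g z) h = ip f h + ip g h"
    and ip_scale: "\<And>c f h. f \<in> H \<Longrightarrow> h \<in> H \<Longrightarrow> ip (\<lambda>z. c * f z) h = c * ip f h"
    and ip_cnj: "\<And>f g. f \<in> H \<Longrightarrow> g \<in> H \<Longrightarrow> ip g f = cnj (ip f g)"
    and ip_nonneg: "\<And>f. f \<in> H \<Longrightarrow> 0 \<le> Re (ip f f)"
    and ip_definite: "\<And>f. f \<in> H \<Longrightarrow> ip f f = 0 \<Longrightarrow> f = (\<lambda>_. 0)"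
    and complete: "\<And>F :: nat \<Rightarrow> complex \<Rightarrow> complex. (\<And>n. F n \<in> H) \<Longrightarrow>
                   (\<forall>e>0. \<exists>N. \<forall>m\<ge>N. \<forall>n\<ge>N. hnorm ip (\<lambda>z. F m z - F n z) < e) \<Longrightarrow>
                   \<exists>f\<in>H. (\<lambda>n. hnorm ip (\<lambda>z. F n z - f z)) \<longlonglongrightarrow> 0"
    and kernel_mem: "\<And>w. w \<in> S \<Longrightarrow> (\<lambda>z. if z \<in> S then K w z else 0) \<in> H"
    and reproducing: "\<And>f w. f \<in> H \<Longrightarrow> w \<in> S \<Longrightarrow>
                   f w = ip f (\<lambda>z. if z \<in> S then K w z else 0)"

definition dBR_kernel :: "(complex \<Rightarrow> complex) \<Rightarrow> complex \<Rightarrow> complex \<Rightarrow> complex" where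
  "dBR_kernel b w z = (1 - cnj (b w) * b z) / (1 - cnj w * z)"

definition de_Branges_Rovnyak ::
  "(complex \<Rightarrow> complex) \<Rightarrow> (complex \<Rightarrow> complex) set \<Rightarrow>
     ((complex \<Rightarrow> complex) \<Rightarrow> (complex \<Rightarrow> complex) \<Rightarrow> complex) \<Rightarrow> bool" where
  "de_Branges_Rovnyak b H ip \<longleftrightarrow>
     rkhs unit_disk (dBR_kernel b) H ip \<and> (\<forall>f\<in>H. f holomorphic_on unit_disk)"

definition admissible_part ::
  "complex measure \<Rightarrow> (complex \<Rightarrow> complex) set \<Rightarrow> (complex \<Rightarrow> complex) set" where
  "admissible_part \<mu> H = {f \<in> H. admissible \<mu> f}"

definition reverse_Carleson ::
  "complex measure \<Rightarrow> (complex \<Rightarrow> complex) set \<Rightarrow>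
     ((complex \<Rightarrow> complex) \<Rightarrow> (complex \<Rightarrow> complex) \<Rightarrow> complex) \<Rightarrow> bool" where
  "reverse_Carleson \<mu> H ip \<longleftrightarrow>
     (\<forall>f\<in>H. \<forall>e>0. \<exists>g\<in>admissible_part \<mu> H. hnorm ip (\<lambda>z. f z - g z) < e) \<and>
     (\<exists>C>0. \<forall>f\<in>admissible_part \<mu> H. ennreal (hnorm ip f) \<le> ennreal C * L2_norm \<mu> f)"


text \<open>The derivative \<^const>\<open>RN_deriv\<close> of \<open>\<nu>\<close> with respect to \<open>M\<close> is only meaningful if \<open>\<nu>\<close> is absolutely
  continuous, so the absolutely continuous part has to be extracted first.\<close>

definition lebesgue_decomposition ::
  "'a measure \<Rightarrow> 'a measure \<Rightarrow> 'a measure \<Rightarrow> 'a measure \<Rightarrow> bool" where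
  "lebesgue_decomposition M \<nu> \<alpha> \<sigma> \<longleftrightarrow>
     sets \<alpha> = sets M \<and> sets \<sigma> = sets M \<and>
     (\<forall>A\<in>sets M. emeasure \<nu> A = emeasure \<alpha> A + emeasure \<sigma> A) \<and>
     absolutely_continuous M \<alpha> \<and>
     (\<exists>N\<in>null_sets M. emeasure \<sigma> (space M - N) = 0)"

definition ac_part :: "'a measure \<Rightarrow> 'a measure \<Rightarrow> 'a measure" where
  "ac_part M \<nu> = (SOME \<alpha>. \<exists>\<sigma>. lebesgue_decomposition M \<nu> \<alpha> \<sigma>)"

definition ac_deriv :: "'a measure \<Rightarrow> 'a measure \<Rightarrow> 'a \<Rightarrow> real" where
  "ac_deriv M \<nu> x = enn2real (RN_deriv M (ac_part M \<nu>) x)"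

lemma lebesgue_decomposition_exists:
  assumes fin: "finite_measure \<nu>" and sets: "sets \<nu> = sets M"
  shows "\<exists>\<alpha> \<sigma>. lebesgue_decomposition M \<nu> \<alpha> \<sigma>"
proof -
  interpret \<nu>: finite_measure \<nu> by (rule fin)
  define s where "s = (SUP N\<in>null_sets M. emeasure \<nu> N)"
  have ne: "null_sets M \<noteq> {}" by (metis empty_iff null_sets.empty_sets)
  obtain X :: "nat \<Rightarrow> ennreal" where X: "range X \<subseteq> emeasure \<nu> ` null_sets M" "s = (SUP i. X i)"
    using ennreal_Sup_countable_SUP[of "emeasure \<nu> ` null_sets M"] ne unfolding s_def by auto
  then have "\<forall>i. \<exists>N. N \<in> null_sets M \<and> X i = emeasure \<nu> N" by auto
  then obtain F where F: "\<And>i. F i \<in> null_sets M" "\<And>i. X i = emeasure \<nu> (F i)" by metis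
  define N where "N = (\<Union>i. F i)"
  have N: "N \<in> null_sets M" unfolding N_def using F(1) by auto
  have N\<nu>: "N \<in> sets \<nu>" using N sets by auto
  have le: "emeasure \<nu> A \<le> emeasure \<nu> N" if "A \<in> null_sets M" for A
  proof -
    have "emeasure \<nu> A \<le> s" unfolding s_def using that by (rule SUP_upper)
    also have "\<dots> \<le> emeasure \<nu> N"
      unfolding X(2) using N\<nu> by (auto intro!: SUP_least emeasure_mono simp: F(2) N_def)
    finally show ?thesis .
  qed
  define \<alpha> where "\<alpha> = density \<nu> (indicator (space M - N))"
  define \<sigma> where "\<sigma> = density \<nu> (indicator N)"
  have space: "space \<nu> = space M" using sets by (rule sets_eq_imp_space_eq)
  have cN: "space M - N \<in> sets \<nu>" using sets.compl_sets[OF N\<nu>] space by simp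
  have em\<alpha>: "emeasure \<alpha> A = emeasure \<nu> (A - N)" if "A \<in> sets M" for A
  proof -
    have "A \<inter> (space M - N) = A - N" using sets.sets_into_space[OF that] by auto
    moreover have "emeasure \<alpha> A = emeasure \<nu> (A \<inter> (space M - N))"
      unfolding \<alpha>_def using that sets emeasure_restricted[OF cN, of A] by (simp add: Int_commute)
    ultimately show ?thesis by simp
  qed
  have em\<sigma>: "emeasure \<sigma> A = emeasure \<nu> (A \<inter> N)" if "A \<in> sets M" for A
    unfolding \<sigma>_def using that sets emeasure_restricted[OF N\<nu>, of A] by (simp add: Int_commute)
  have ac: "emeasure \<nu> (A - N) = 0" if A: "A \<in> null_sets M" for A
  proof -
    have A\<nu>: "A \<in> sets \<nu>" using A sets by auto
    have "emeasure \<nu> (A - N) + emeasure \<nu> N = emeasure \<nu> ((A - N) \<union> N)"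
      using A\<nu> N\<nu> by (subst plus_emeasure) auto
    also have "(A - N) \<union> N = A \<union> N" by auto
    also have "emeasure \<nu> (A \<union> N) \<le> emeasure \<nu> N" using le A N by auto
    finally show ?thesis
      using \<nu>.emeasure_finite[of N] by (metis add.commute add.right_neutral
        ennreal_add_left_cancel_le infinity_ennreal_def le_zero_eq)
  qed
  have "lebesgue_decomposition M \<nu> \<alpha> \<sigma>"
    unfolding lebesgue_decomposition_def absolutely_continuous_def
  proof (intro conjI ballI bexI[OF _ N] subsetI)
    show "sets \<alpha> = sets M" "sets \<sigma> = sets M" using sets by (auto simp: \<alpha>_def \<sigma>_def)
    show "emeasure \<nu> A = emeasure \<alpha> A + emeasure \<sigma> A" if "A \<in> sets M" for A
    proof -
      have "emeasure \<nu> (A - N) + emeasure \<nu> (A \<inter> N) = emeasure \<nu> ((A - N) \<union> (A \<inter> N))"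
        using that N\<nu> sets by (subst plus_emeasure) auto
      also have "(A - N) \<union> (A \<inter> N) = A" by auto
      finally show ?thesis using that by (simp add: em\<alpha> em\<sigma>)
    qed
    show "A \<in> null_sets \<alpha>" if "A \<in> null_sets M" for A
      using that ac[OF that] em\<alpha>[of A] by (auto simp: null_sets_def \<alpha>_def sets)
    have "(space M - N) \<inter> N = {}" by auto
    then show "emeasure \<sigma> (space M - N) = 0"
      using em\<sigma>[of "space M - N"] N by auto
  qed
  then show ?thesis by blast
qed

lemma lebesgue_decomposition_ac_part:
  assumes "finite_measure \<nu>" and "sets \<nu> = sets M"
  shows "\<exists>\<sigma>. lebesgue_decomposition M \<nu> (ac_part M \<nu>) \<sigma>"
  unfolding ac_part_def using lebesgue_decomposition_exists[OF assms] by (rule someI_ex)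

end

theory Submission
  imports Defs "HOL-Complex_Analysis.Complex_Analysis"
begin

text \<open>Test the reverse Carleson inequality on the kernel functions at \<open>\<lambda> = r \<zeta>\<close>:
  \<open>1 - |b(\<lambda>)|\<^sup>2\<close> is at most \<open>C\<^sup>2\<close> times the integral of
  \<open>|1 - cnj (b \<lambda>) b(z)|\<^sup>2 (1 - |\<lambda>|\<^sup>2) / |1 - cnj \<lambda> z|\<^sup>2\<close> over \<open>d\<mu>(z)\<close>.
  Integrate this over \<open>\<zeta>\<close> in a closed subset \<open>K\<close> of the circle and let \<open>r\<close> tend to 1. By Fatou's
  theorem the left-hand side tends to the integral of \<open>1 - |b|\<^sup>2\<close> over \<open>K\<close>. On the right, by Fubini,
  a Poisson average around \<open>z\<close> is integrated against \<open>\<mu>\<close>. This average is bounded; it tends to 0 if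
  \<open>z\<close> is in the disk, and it is concentrated on a Stolz angle at \<open>z\<close> if \<open>z\<close> is on the circle, where
  \<open>b\<close> has a non-tangential limit, so that its upper limit is at most a constant times
  \<open>1\<^sub>K(z) (1 - |b(z)|\<^sup>2)\<^sup>2\<close>. The resulting inequality between measures passes from closed to Borel sets,
  and off a null set carrying the singular part of \<open>\<mu>\<close> it is an inequality between densities.

  Fatou's theorem follows from the differentiability almost everywhere of Lipschitz functions: a
  primitive \<open>G\<close> of \<open>b\<close> extends to a Lipschitz function on the closed disk. Where \<open>G\<close> is
  differentiable along the circle, its difference quotient has a limit along the circle and hence,
  by the maximum principle, in the disk; Cauchy's estimate turns this into a non-tangential limit
  of \<open>b = G'\<close>.\<close>

section \<open>Lipschitz functions are differentiable almost everywhere\<close>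

text \<open>Lebesgue measure is determined by its values on open intervals, and there the two
  Stieltjes measures add up to the length because \<open>F + G\<close> is the identity. Consequently
  each summand is dominated by Lebesgue measure.\<close>

lemma lborel_eq_sum_interval_measures:
  fixes F G :: "real \<Rightarrow> real"
  assumes mono: "mono F" "mono G" and cont: "continuous_on UNIV F" "continuous_on UNIV G"
    and sum: "\<And>x. F x + G x = x" and A: "A \<in> sets borel"
  shows "emeasure lborel A = emeasure (interval_measure F) A + emeasure (interval_measure G) A"
proof -
  define S where "S = measure_of (UNIV::real set) (sets borel)
    (\<lambda>A. emeasure (interval_measure F) A + emeasure (interval_measure G) A)"
  have sets_S: "sets S = sets borel"
    unfolding S_def by (simp add: sigma_algebra.sets_measure_of_eq[OF sets.sigma_algebra_axioms[of borel, simplified]])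
  have em: "emeasure S A = emeasure (interval_measure F) A + emeasure (interval_measure G) A"
    if "A \<in> sets borel" for A
    unfolding S_def
  proof (rule emeasure_measure_of_sigma)
    show "sigma_algebra (UNIV::real set) (sets borel)"
      using sets.sigma_algebra_axioms[of "borel :: real measure"] by simp
    show "countably_additive (sets borel)
      (\<lambda>A. emeasure (interval_measure F) A + emeasure (interval_measure G) A)"
      unfolding countably_additive_def
      by (auto simp: suminf_add[symmetric] suminf_emeasure)
  qed (use that in \<open>auto simp: positive_def\<close>)
  \<comment> \<open>Continuity makes endpoints null, so the value on half-open intervals carries
    over to open ones.\<close>
  have Ioo: "emeasure (interval_measure H) {l<..<u} = H u - H l"
    if H: "mono H" "continuous_on UNIV H" and "l \<le> u" for H :: "real \<Rightarrow> real" and l u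
  proof (cases "l = u")
    case False
    have "emeasure (interval_measure H) {u} = 0"
      using emeasure_interval_measure_Icc[of u u H] H by (auto simp: monoD)
    then have "{u} \<in> null_sets (interval_measure H)" by auto
    then have "emeasure (interval_measure H) ({l<..u} - {u}) = emeasure (interval_measure H) {l<..u}"
      by (intro emeasure_Diff_null_set) auto
    moreover have "{l<..u} - {u} = {l<..<u}" by auto
    moreover have "continuous (at_right a) H" for a
      using H(2) continuous_at_imp_continuous_within continuous_on_eq_continuous_at open_UNIV by blast
    ultimately show ?thesis
      using emeasure_interval_measure_Ioc[of l u H] H(1) that(3) by (auto simp: monoD)
  qed auto
  have "lborel = S"
  proof (rule lborel_eqI[OF _ sets_S])
    fix l u :: real assume "\<And>b. b \<in> Basis \<Longrightarrow> l \<bullet> b \<le> u \<bullet> b"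
    then have lu: "l \<le> u" by auto
    have "emeasure S (box l u) = ennreal (F u - F l) + ennreal (G u - G l)"
      using em[of "box l u"] Ioo[OF mono(1) cont(1) lu] Ioo[OF mono(2) cont(2) lu] by simp
    also have "\<dots> = ennreal (u - l)"
      using sum[of u] sum[of l] monoD[OF mono(1) lu] monoD[OF mono(2) lu]
      by (subst ennreal_plus[symmetric]) (auto intro!: arg_cong[where f=ennreal] simp del: ennreal_plus)
    finally show "emeasure S (box l u) = (\<Prod>b\<in>Basis. (u - l) \<bullet> b)" by simp
  qed
  then show ?thesis using em[OF A] by simp
qed

text \<open>A 1-Lipschitz function is the difference of the increasing functions (x + f x) / 2 and
  (x - f x) / 2, whose sum is x. The Stieltjes measure of the first one therefore lies below
  Lebesgue measure, and Radon-Nikodym provides a density.\<close>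

lemma lipschitz_indefinite_integral:
  fixes f :: "real \<Rightarrow> real"
  assumes lip: "\<And>x y. \<bar>f x - f y\<bar> \<le> \<bar>x - y\<bar>"
  obtains g where "\<And>a b. a \<le> b \<Longrightarrow> (g has_integral (f b - f a)) {a..b}"
proof -
  define F where "F x = (x + f x) / 2" for x
  define G where "G x = (x - f x) / 2" for x
  have cf: "continuous_on UNIV f"
  proof -
    have "1-lipschitz_on UNIV f" by (rule lipschitz_onI) (use lip in \<open>auto simp: dist_real_def\<close>)
    then show ?thesis by (rule lipschitz_on_continuous_on)
  qed
  have mono: "mono F" "mono G"
  proof -
    have "F x \<le> F y" "G x \<le> G y" if "x \<le> y" for x y
      using lip[of x y] that by (auto simp: F_def G_def abs_le_iff)
    then show "mono F" "mono G" by (auto intro: monoI)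
  qed
  have cont: "continuous_on UNIV F" "continuous_on UNIV G"
    unfolding F_def G_def by (auto intro!: continuous_intros cf)
  have sum: "F x + G x = x" for x by (simp add: F_def G_def field_simps)
  define N where "N = interval_measure F"
  have setsN: "sets N = sets borel" by (simp add: N_def)
  have le: "emeasure N A \<le> emeasure lborel A" if "A \<in> sets borel" for A
    using lborel_eq_sum_interval_measures[OF mono cont sum that] by (simp add: N_def)
  have ac: "absolutely_continuous lborel N"
    unfolding absolutely_continuous_def
    using le by (fastforce simp: null_sets_def setsN)
  then obtain k where k[measurable]: "k \<in> borel_measurable lborel" and dk: "density lborel k = N"
    using sigma_finite_measure.Radon_Nikodym[OF sigma_finite_lborel, of N] setsN by auto
  have kI: "(\<integral>\<^sup>+x\<in>{a..b}. k x \<partial>lborel) = ennreal (F b - F a)" if "a \<le> b" for a b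
    using emeasure_interval_measure_Icc[OF that, of F] mono(1) cont(1)
    by (simp add: dk[symmetric, unfolded N_def] monoD emeasure_density)
  \<comment> \<open>The density has finite integral over each interval [-n, n], so it is finite
    there almost everywhere, and these intervals exhaust the line.\<close>
  have kfin: "AE x in lborel. k x \<noteq> \<infinity>"
  proof -
    have "AE x in lborel. \<forall>n::nat. x \<in> {-real n..real n} \<longrightarrow> k x \<noteq> \<infinity>"
      unfolding AE_all_countable
    proof
      fix n :: nat
      have "AE x in lborel. k x * indicator {-real n..real n} x \<noteq> \<infinity>"
        by (rule nn_integral_PInf_AE) (auto simp: kI)
      then show "AE x in lborel. x \<in> {-real n..real n} \<longrightarrow> k x \<noteq> \<infinity>"
        by eventually_elim auto
    qed
    then show ?thesis
    proof eventually_elim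
      fix x :: real
      assume *: "\<forall>n::nat. x \<in> {-real n..real n} \<longrightarrow> k x \<noteq> \<infinity>"
      obtain n :: nat where "\<bar>x\<bar> \<le> real n" using real_arch_simple by blast
      then have "x \<in> {-real n..real n}" by auto
      with * show "k x \<noteq> \<infinity>" by blast
    qed
  qed
  have int: "((\<lambda>x. enn2real (k x)) has_integral (F b - F a)) {a..b}" if "a \<le> b" for a b
  proof -
    have "(\<integral>\<^sup>+x. ennreal (enn2real (k x) * indicator {a..b} x) \<partial>lborel) = ennreal (F b - F a)"
      unfolding kI[OF that, symmetric] using kfin
      by (intro nn_integral_cong_AE, eventually_elim) (auto simp: indicator_def less_top)
    then have "((\<lambda>x. enn2real (k x) * indicator {a..b} x) has_integral (F b - F a)) UNIV"
      using monoD[OF mono(1) that] by (intro nn_integral_has_integral) auto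
    then show ?thesis
      by (subst has_integral_restrict_UNIV[symmetric], elim has_integral_eq_rhs[OF has_integral_eq, rotated]) (auto simp: indicator_def)
  qed
  \<comment> \<open>Since \<open>f x = 2 * F x - x\<close>, twice the density of \<open>F\<close>
    minus 1 is a density for \<open>f\<close>.\<close>
  have "((\<lambda>x. 2 * enn2real (k x) - 1) has_integral (f b - f a)) {a..b}" if "a \<le> b" for a b
  proof -
    have "((\<lambda>x. 2 * enn2real (k x) - 1) has_integral (2 * (F b - F a) - (b - a))) {a..b}"
      using has_integral_const_real[of "1::real" a b] that
      by (intro has_integral_diff has_integral_mult_right int[OF that]) auto
    then show ?thesis by (rule has_integral_eq_rhs) (simp add: F_def field_simps)
  qed
  then show ?thesis using that by blast
qed

text \<open>This is Lebesgue differentiation. The averages in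
  \<open>integrable_ccontinuous_explicit\<close> run over [x, x + h] with h > 0, so only a right
  derivative comes out.\<close>

lemma lipschitz_AE_right_derivative:
  fixes f :: "real \<Rightarrow> real"
  assumes "\<And>a b. a \<le> b \<Longrightarrow> (g has_integral (f b - f a)) {a..b}"
  shows "\<exists>N. negligible N \<and> (\<forall>x. x \<notin> N \<longrightarrow> ((\<lambda>h. (f (x + h) - f x) / h) \<longlongrightarrow> g x) (at_right 0))"
proof -
  have "g integrable_on cbox a b" for a b :: real
    using assms[of a b] by (cases "a \<le> b") (auto simp: integrable_on_def)
  then obtain N where N: "negligible N"
    "\<And>x e. \<lbrakk>x \<notin> N; 0 < e\<rbrakk> \<Longrightarrow> \<exists>d>0. \<forall>h. 0 < h \<and> h < d \<longrightarrow>
       norm(integral (cbox x (x + h *\<^sub>R One)) g /\<^sub>R h ^ DIM(real) - g x) < e"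
    by (rule integrable_ccontinuous_explicit) blast
  have "((\<lambda>h. (f (x + h) - f x) / h) \<longlongrightarrow> g x) (at_right 0)" if x: "x \<notin> N" for x
  proof (rule tendstoI)
    fix e :: real assume "e > 0"
    from N(2)[OF x this] obtain d where d: "d > 0" "\<forall>h. 0 < h \<and> h < d \<longrightarrow>
       norm(integral (cbox x (x + h *\<^sub>R One)) g /\<^sub>R h ^ DIM(real) - g x) < e"
      by (elim exE conjE)
    show "\<forall>\<^sub>F h in at_right 0. dist ((f (x + h) - f x) / h) (g x) < e"
      unfolding eventually_at_right_field
    proof (intro exI[of _ d] conjI allI impI)
      fix h :: real assume h: "0 < h" "h < d"
      have "integral {x..x + h} g = f (x + h) - f x"
        using assms[of x "x + h"] h by (intro integral_unique) auto
      then have "integral (cbox x (x + h *\<^sub>R One)) g /\<^sub>R h ^ DIM(real) = (f (x + h) - f x) / h"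
        by (simp add: divide_inverse_commute)
      then show "dist ((f (x + h) - f x) / h) (g x) < e"
        using d(2)[rule_format, OF conjI[OF h]] by (simp only: dist_norm)
    qed (use d in auto)
  qed
  then show ?thesis using N(1) by blast
qed

text \<open>The left derivative of \<open>f\<close> at x is the right derivative at -x of the
  reflected function - f (- x). The reflection has density g (- x), so both one-sided derivatives
  equal \<open>g x\<close>.\<close>

lemma lipschitz_AE_differentiable:
  fixes f :: "real \<Rightarrow> real"
  assumes lip: "\<And>x y. \<bar>f x - f y\<bar> \<le> \<bar>x - y\<bar>"
  shows "\<exists>N. negligible N \<and> (\<forall>x. x \<notin> N \<longrightarrow> f differentiable (at x))"
proof -
  obtain g where g: "\<And>a b. a \<le> b \<Longrightarrow> (g has_integral (f b - f a)) {a..b}"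
    using lipschitz_indefinite_integral[OF lip] by blast
  obtain N where N: "negligible N"
    "\<And>x. x \<notin> N \<Longrightarrow> ((\<lambda>h. (f (x + h) - f x) / h) \<longlongrightarrow> g x) (at_right 0)"
    using lipschitz_AE_right_derivative[OF g] by blast
  define f' where "f' x = - f (- x)" for x
  have g': "((\<lambda>x. g (- x)) has_integral (f' b - f' a)) {a..b}" if "a \<le> b" for a b
    using g[of "-b" "-a"] that unfolding f'_def by (subst has_integral_reflect_real[symmetric]) auto
  obtain N' where N': "negligible N'"
    "\<And>x. x \<notin> N' \<Longrightarrow> ((\<lambda>h. (f' (x + h) - f' x) / h) \<longlongrightarrow> g (- x)) (at_right 0)"
    using lipschitz_AE_right_derivative[OF g'] by blast
  have "f differentiable (at x)" if x: "x \<notin> N \<union> uminus ` N'" for x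
  proof -
    have "- x \<notin> N'" using x by force
    then have "((\<lambda>h. (f' (- x + h) - f' (- x)) / h) \<longlongrightarrow> g x) (at_right 0)"
      using N'(2)[of "-x"] by simp
    moreover have "(f' (- x + h) - f' (- x)) / h = (f (x + - h) - f x) / - h" for h
      by (cases "h = 0") (simp_all add: f'_def field_simps)
    ultimately have "((\<lambda>h. (f (x + h) - f x) / h) \<longlongrightarrow> g x) (at_left 0)"
      by (subst filterlim_at_left_to_right) simp
    moreover have "((\<lambda>h. (f (x + h) - f x) / h) \<longlongrightarrow> g x) (at_right 0)" using N(2) x by auto
    ultimately have "((\<lambda>h. (f (x + h) - f x) / h) \<longlongrightarrow> g x) (at 0)"
      by (simp add: filterlim_split_at)
    then have "(f has_field_derivative g x) (at x)" by (simp add: DERIV_def)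
    then show ?thesis using real_differentiable_def by blast
  qed
  moreover have "negligible (N \<union> uminus ` N')"
    using N(1) N'(1)
    by (intro negligible_Un negligible_differentiable_image_negligible)
      (auto intro!: linear_imp_differentiable_on linear_uminus)
  ultimately show ?thesis by blast
qed

section \<open>Boundary limits of bounded holomorphic functions\<close>

text \<open>If \<open>B < a\<close>, the powers of \<open>a / B\<close> would be unbounded, whereas
  the assumption bounds them by \<open>D / d\<close>. This is the n-th root argument that removes
  constants from an estimate valid for all powers.\<close>

lemma norm_le_if_norm_power_mult_le:
  fixes a B :: real
  assumes "\<And>n::nat. a ^ n * d \<le> D * B ^ n" and "0 < d" "0 < B" "0 \<le> a"
  shows "a \<le> B"
proof (rule ccontr)
  assume "\<not> a \<le> B"
  then have "1 < a / B" using assms by simp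
  then obtain n where n: "D / d < (a / B) ^ n" using real_arch_pow by blast
  have "(a / B) ^ n \<le> D / d"
    using assms(1)[of n] assms(2,3) by (simp add: power_divide field_simps)
  with n show False by simp
qed

text \<open>Apply the maximum principle to \<open>f\<^sup>n (z - \<zeta>)\<close>: the factor removes the exceptional point, and its
  influence disappears as \<open>n\<close> grows.\<close>

lemma maximum_modulus_except_one_point:
  fixes f :: "complex \<Rightarrow> complex"
  assumes hol: "f holomorphic_on ball 0 1" and cont: "continuous_on (cball 0 1 - {\<zeta>}) f"
    and bdd: "\<And>z. z \<in> cball 0 1 - {\<zeta>} \<Longrightarrow> norm (f z) \<le> M"
    and bdry: "\<And>z. z \<in> sphere 0 1 - {\<zeta>} \<Longrightarrow> norm (f z) \<le> B"
    and "\<zeta> \<in> sphere 0 1" "0 < B" "z \<in> ball 0 1"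
  shows "norm (f z) \<le> B"
proof (rule norm_le_if_norm_power_mult_le)
  show "0 < norm (z - \<zeta>)" using assms by auto
  fix n :: nat
  define g where "g w = (if w = \<zeta> then 0 else f w ^ n * (w - \<zeta>))" for w
  have "norm (f 0) \<le> M" by (rule bdd) (use \<open>\<zeta> \<in> sphere 0 1\<close> in auto)
  then have M: "0 \<le> M" using norm_ge_zero order_trans by blast
  have "norm (g z) \<le> 2 * B ^ n"
  proof (rule maximum_modulus_frontier[of g "cball 0 1"])
    have "(\<lambda>w. f w ^ n * (w - \<zeta>)) holomorphic_on ball 0 1"
      by (intro holomorphic_intros hol)
    then show "g holomorphic_on interior (cball 0 1)"
      by (simp, elim holomorphic_transform) (use assms in \<open>auto simp: g_def\<close>)
    have "(g \<longlongrightarrow> g w) (at w within cball 0 1)" if w: "w \<in> cball 0 1" for w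
    proof (cases "w = \<zeta>")
      case False
      have "((\<lambda>w. f w ^ n * (w - \<zeta>)) \<longlongrightarrow> f w ^ n * (w - \<zeta>)) (at w within cball 0 1 - {\<zeta>})"
        using cont w False by (intro tendsto_intros) (auto simp: continuous_on_def)
      moreover have "at w within cball 0 1 - {\<zeta>} = at w within cball 0 1"
        by (rule at_within_nhd[of w "- {\<zeta>}"]) (use False in auto)
      ultimately have "((\<lambda>w. f w ^ n * (w - \<zeta>)) \<longlongrightarrow> g w) (at w within cball 0 1)"
        using False by (simp add: g_def)
      moreover have "\<forall>\<^sub>F v in at w within cball 0 1. v \<noteq> \<zeta>"
        using False by (auto simp: eventually_at dist_commute intro!: exI[of _ "dist w \<zeta>"])
      ultimately show ?thesis
        by (elim Lim_transform_eventually) (auto elim!: eventually_mono simp: g_def)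
    next
      \<comment> \<open>At the exceptional point the linear factor tends to 0 while \<open>f\<close>
        stays bounded.\<close>
      case True
      have "((\<lambda>v. M ^ n * norm (v - \<zeta>)) \<longlongrightarrow> M ^ n * norm (\<zeta> - \<zeta>)) (at w within cball 0 1)"
        unfolding True by (intro tendsto_intros)
      moreover have "\<forall>\<^sub>F v in at w within cball 0 1. norm (g v) \<le> M ^ n * norm (v - \<zeta>)"
        unfolding eventually_at_filter using bdd M
        by (intro always_eventually)
          (auto simp: g_def norm_mult norm_power intro!: mult_right_mono power_mono)
      ultimately show ?thesis
        using True by (auto simp: g_def intro: Lim_null_comparison)
    qed
    then show "continuous_on (closure (cball 0 1)) g" by (simp add: continuous_on_def)
    fix w assume "w \<in> frontier (cball (0::complex) 1)"
    then have w: "w \<in> sphere 0 1" by simp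
    have "norm (w - \<zeta>) \<le> 2" using w \<open>\<zeta> \<in> sphere 0 1\<close> norm_triangle_ineq4[of w \<zeta>] by simp
    then show "norm (g w) \<le> 2 * B ^ n"
      using bdry[of w] w \<open>0 < B\<close>
      by (auto simp: g_def norm_mult norm_power mult.commute[of 2] intro!: mult_mono power_mono)
  qed (use assms in auto)
  then show "norm (f z) ^ n * norm (z - \<zeta>) \<le> 2 * B ^ n"
    using assms by (auto simp: g_def norm_mult norm_power split: if_splits)
qed (use assms in auto)

text \<open>Multiply \<open>Q\<close> by a high power of a function peaking at \<zeta>. On the
  circle the product is small near \<zeta> because \<open>Q\<close> is, and elsewhere because the
  power is; the maximum principle carries the bound into the disk. Close to \<zeta> the power is
  almost 1 and can be divided out.\<close>

lemma tendsto_disk_if_tendsto_circle: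
  fixes Q :: "complex \<Rightarrow> complex"
  assumes hol: "Q holomorphic_on ball 0 1" and cont: "continuous_on (cball 0 1 - {\<zeta>}) Q"
    and bdd: "\<And>z. z \<in> cball 0 1 - {\<zeta>} \<Longrightarrow> norm (Q z) \<le> M"
    and lim: "(Q \<longlongrightarrow> 0) (at \<zeta> within sphere 0 1)" and \<zeta>: "\<zeta> \<in> sphere 0 1"
  shows "(Q \<longlongrightarrow> 0) (at \<zeta> within ball 0 1)"
proof (rule tendstoI)
  fix e :: real assume "e > 0"
  obtain d where d: "d > 0" "\<And>z. z \<in> sphere 0 1 \<Longrightarrow> z \<noteq> \<zeta> \<Longrightarrow> dist z \<zeta> < d \<Longrightarrow> norm (Q z) < e / 4"
    using tendstoD[OF lim, of "e / 4"] \<open>e > 0\<close> by (auto simp: eventually_at)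
  have n\<zeta>: "norm \<zeta> = 1" using \<zeta> by simp
  \<comment> \<open>a peak function: \<open>u \<zeta> = 1\<close>, and \<open>u\<close> has modulus less than 1 elsewhere on the closed disk\<close>
  define u where "u z = (1 + cnj \<zeta> * z) / 2" for z
  have nu: "norm (u z) \<le> 1" if "norm z \<le> 1" for z
    using norm_triangle_ineq[of 1 "cnj \<zeta> * z"] that n\<zeta> by (simp add: u_def norm_mult norm_divide)
  have usq: "(norm (u z))\<^sup>2 = 1 - (dist z \<zeta>)\<^sup>2 / 4" if "norm z = 1" for z
  proof -
    \<comment> \<open>Parallelogram law for 1 and \<open>cnj \<zeta> * z\<close>.\<close>
    have "(norm (1 + cnj \<zeta> * z))\<^sup>2 + (norm (1 - cnj \<zeta> * z))\<^sup>2 = 2 + 2 * (norm (cnj \<zeta> * z))\<^sup>2"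
      unfolding cmod_power2 by (simp add: power2_eq_square algebra_simps)
    moreover have "norm (1 - cnj \<zeta> * z) = dist z \<zeta>"
    proof -
      have "cnj \<zeta> * \<zeta> = 1" using n\<zeta> by (simp add: mult.commute complex_norm_square[symmetric])
      then have "1 - cnj \<zeta> * z = cnj \<zeta> * (\<zeta> - z)" by (simp add: algebra_simps)
      then show ?thesis using n\<zeta> by (simp add: norm_mult dist_norm norm_minus_commute)
    qed
    ultimately show ?thesis
      using that n\<zeta> by (simp add: u_def norm_mult norm_divide power_divide)
  qed
  \<comment> \<open>A bound for the peak function at distance at least \<open>d\<close> from
    \<zeta>. The \<open>max 0\<close> covers \<open>d > 2\<close>, when no point of the circle is
    that far away.\<close>
  define q where "q = sqrt (max 0 (1 - d\<^sup>2 / 4))"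
  have q: "0 \<le> q" "q < 1" using d(1) by (auto simp: q_def)
  have uq: "norm (u z) \<le> q" if "norm z = 1" "dist z \<zeta> \<ge> d" for z
  proof -
    have "(norm (u z))\<^sup>2 \<le> 1 - d\<^sup>2 / 4" using usq[OF that(1)] that(2) d(1) power_mono[of d "dist z \<zeta>" 2] by simp
    then show ?thesis unfolding q_def by (intro real_le_rsqrt) simp
  qed
  have "norm (Q 0) \<le> M" by (rule bdd) (use n\<zeta> in auto)
  then have M: "0 \<le> M" using norm_ge_zero order_trans by blast
  have "(\<lambda>n. M * q ^ n) \<longlonglongrightarrow> M * 0"
    using q by (intro tendsto_intros LIMSEQ_realpow_zero) auto
  then have "\<forall>\<^sub>F n in sequentially. M * q ^ n < e / 4"
    using \<open>e > 0\<close> by (intro order_tendstoD) auto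
  then obtain n where n: "M * q ^ n < e / 4" by (auto simp: eventually_sequentially)
  define f where "f z = Q z * u z ^ n" for z
  have "norm (f z) \<le> e / 4" if "z \<in> ball 0 1" for z
  proof (rule maximum_modulus_except_one_point[where f=f and \<zeta>=\<zeta> and M=M])
    show "f holomorphic_on ball 0 1"
      unfolding f_def u_def by (intro holomorphic_intros hol) auto
    show "continuous_on (cball 0 1 - {\<zeta>}) f"
      unfolding f_def u_def by (intro continuous_intros cont) auto
    show "norm (f w) \<le> M" if "w \<in> cball 0 1 - {\<zeta>}" for w
    proof -
      have "norm (f w) \<le> M * 1"
        unfolding f_def norm_mult norm_power using that M
        by (intro mult_mono bdd power_le_one nu) auto
      then show ?thesis by simp
    qed
    show "norm (f w) \<le> e / 4" if w: "w \<in> sphere 0 1 - {\<zeta>}" for w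
    proof (cases "dist w \<zeta> < d")
      case True
      then have "norm (f w) \<le> e / 4 * 1"
        unfolding f_def norm_mult norm_power using w d(2)[of w] \<open>e > 0\<close>
        by (intro mult_mono power_le_one nu) auto
      then show ?thesis by simp
    next
      case False
      have "norm (f w) \<le> M * q ^ n"
        unfolding f_def norm_mult norm_power using w M False
        by (intro mult_mono bdd power_mono uq) auto
      then show ?thesis using n by simp
    qed
  qed (use \<zeta> \<open>e > 0\<close> that in auto)
  \<comment> \<open>The exponent \<open>n\<close> is fixed by now, so continuity at \<zeta>, where
    the power equals 1, keeps its modulus above 1/2 nearby.\<close>
  moreover have "((\<lambda>z. u z ^ n) \<longlongrightarrow> u \<zeta> ^ n) (at \<zeta> within ball 0 1)"
    unfolding u_def by (intro tendsto_intros) auto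
  moreover have "u \<zeta> = 1"
    using n\<zeta> by (simp add: u_def mult.commute complex_norm_square[symmetric])
  ultimately have "\<forall>\<^sub>F z in at \<zeta> within ball 0 1. dist (u z ^ n) 1 < 1/2"
    by (intro tendstoD) auto
  moreover have "\<forall>\<^sub>F z in at \<zeta> within ball 0 1. z \<in> ball 0 1"
    by (auto simp: eventually_at_filter)
  ultimately show "\<forall>\<^sub>F z in at \<zeta> within ball 0 1. dist (Q z) 0 < e"
  proof eventually_elim
    case (elim z)
    have "1 - norm (u z ^ n) \<le> norm (1 - u z ^ n)"
      using norm_triangle_ineq2[of 1 "u z ^ n"] by simp
    then have half: "1/2 < norm (u z ^ n)" using elim(1) by (simp add: dist_norm norm_minus_commute)
    have "norm (Q z) * (1/2) \<le> norm (Q z) * norm (u z ^ n)"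
      using half by (intro mult_left_mono) auto
    also have "\<dots> \<le> e / 4"
      using \<open>\<And>z. z \<in> ball 0 1 \<Longrightarrow> norm (f z) \<le> e / 4\<close>[OF elim(2)] by (simp add: f_def norm_mult)
    finally show ?case using \<open>e > 0\<close> by simp
  qed
qed

section \<open>Estimates of the Poisson kernel\<close>

text \<open>On [0, 1] the Taylor remainder is at most x/6, which gives even x/2 as a lower bound.
  Beyond 1 the sine increases, and sin 1 >= 1/2 >= x/4 because x <= pi/2 < 2.\<close>

lemma quarter_le_sin:
  assumes "0 \<le> x" "x \<le> pi / 2"
  shows "x / 4 \<le> sin (x::real)"
proof -
  have small: "x / 2 \<le> sin x" if "0 \<le> x" "x \<le> 1" for x :: real
  proof -
    have "\<bar>sin x - (\<Sum>m<3. sin_coeff m * x ^ m)\<bar> \<le> inverse (fact 3) * \<bar>x\<bar> ^ 3"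
      by (rule Maclaurin_sin_bound)
    moreover have "(\<Sum>m<3. sin_coeff m * x ^ m) = x"
      by (simp add: eval_nat_numeral sin_coeff_def)
    moreover have "x - sin x \<le> \<bar>sin x - x\<bar>" by simp
    ultimately have "x - sin x \<le> x ^ 3 / 6"
      using that(1) by (simp add: fact_numeral)
    moreover have "x ^ 3 \<le> x" using that power_decreasing[of 1 3 x] by simp
    ultimately show ?thesis using that(1) by simp
  qed
  show ?thesis
  proof (cases "x \<le> 1")
    case False
    have "sin 1 \<le> sin x" using False assms by (intro sin_monotone_2pi_le) auto
    then show ?thesis using small[of 1] assms pi_less_4 by simp
  qed (use small[of x] assms in simp)
qed

text \<open>The left-over square is computed exactly: |1 - r e^(it)|^2 = (1 - r)^2 + 4 r sin^2(t/2).
  With 4 r >= 2 and |sin(t/2)| >= |t|/8, the second term is at least t^2/32.\<close>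

lemma norm_one_minus_cis_ge:
  assumes r: "1/2 \<le> r" and t: "\<bar>t\<bar> \<le> pi"
  shows "((1 - r)\<^sup>2 + t\<^sup>2) / 32 \<le> (norm (1 - of_real r * cis t))\<^sup>2"
proof -
  have "\<bar>t\<bar> / 2 / 4 \<le> sin (\<bar>t\<bar> / 2)" using t by (intro quarter_le_sin) auto
  then have "(\<bar>t\<bar> / 2 / 4)\<^sup>2 \<le> (sin (\<bar>t\<bar> / 2))\<^sup>2" by (intro power_mono) auto
  also have "(sin (\<bar>t\<bar> / 2))\<^sup>2 = (sin (t / 2))\<^sup>2" by (cases "t \<ge> 0") auto
  finally have s: "t\<^sup>2 / 64 \<le> (sin (t / 2))\<^sup>2" by (simp add: power_divide)
  have "(norm (1 - of_real r * cis t))\<^sup>2 = (1 - r * cos t)\<^sup>2 + (r * sin t)\<^sup>2"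
    by (simp add: cmod_power2)
  also have "\<dots> = (1 - r)\<^sup>2 + 2 * r * (1 - cos t)"
    unfolding power_mult_distrib sin_squared_eq by (simp add: power2_eq_square algebra_simps)
  also have "1 - cos t = 2 * (sin (t / 2))\<^sup>2" using cos_double_sin[of "t / 2"] by simp
  finally have n: "(norm (1 - of_real r * cis t))\<^sup>2 = (1 - r)\<^sup>2 + 4 * r * (sin (t / 2))\<^sup>2" by simp
  have "2 * (t\<^sup>2 / 64) \<le> 4 * r * (sin (t / 2))\<^sup>2" using s r by (intro mult_mono) auto
  then have "(1 - r)\<^sup>2 / 32 + 2 * (t\<^sup>2 / 64) \<le> (1 - r)\<^sup>2 + 4 * r * (sin (t / 2))\<^sup>2"
    by (intro add_mono) auto
  then show ?thesis unfolding n by (simp add: add_divide_distrib)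
qed

text \<open>For \<zeta> and z on the circle this is the Poisson kernel of the point w = r \<zeta>.
  For z in the disk, where \<mu> may also have mass, it is 1 - |w|^2 times the squared modulus of
  the Szego kernel 1 / (1 - cnj w * z).\<close>

definition poisson :: "real \<Rightarrow> complex \<Rightarrow> complex \<Rightarrow> real" where
  "poisson r \<zeta> z = (1 - r\<^sup>2) / (norm (1 - of_real r * cnj \<zeta> * z))\<^sup>2"

lemma poisson_nonneg: "0 \<le> r \<Longrightarrow> r \<le> 1 \<Longrightarrow> 0 \<le> poisson r \<zeta> z"
  by (simp add: poisson_def power_le_one)

text \<open>In the scaled variable s = t / \<delta> the kernel times the Jacobian \<delta> is
  dominated by a multiple of 1 / (1 + s^2), uniformly in \<delta>. This majorant serves the later
  passages to the limit.\<close>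

lemma poisson_cis_le:
  assumes \<delta>: "0 < \<delta>" "\<delta> \<le> 1/2" and t: "\<bar>t\<bar> \<le> pi"
  shows "\<delta> * poisson (1 - \<delta>) (cis t) 1 \<le> 64 / (1 + (t / \<delta>)\<^sup>2)"
proof -
  have "(\<delta>\<^sup>2 + t\<^sup>2) / 32 \<le> (norm (1 - of_real (1 - \<delta>) * cis (- t)))\<^sup>2"
    using norm_one_minus_cis_ge[of "1 - \<delta>" "- t"] assms by simp
  then have n: "(\<delta>\<^sup>2 + t\<^sup>2) / 32 \<le> (norm (1 - of_real (1 - \<delta>) * cnj (cis t) * 1))\<^sup>2"
    by (simp add: cis_cnj)
  have pos: "0 < \<delta>\<^sup>2 + t\<^sup>2" using \<delta> by (simp add: add_pos_nonneg)
  have "1 - (1 - \<delta>)\<^sup>2 \<le> 2 * \<delta>" by (simp add: power2_eq_square algebra_simps)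
  then have "poisson (1 - \<delta>) (cis t) 1 \<le> 2 * \<delta> / ((\<delta>\<^sup>2 + t\<^sup>2) / 32)"
    unfolding poisson_def using n pos \<delta> by (intro frac_le) auto
  then have "\<delta> * poisson (1 - \<delta>) (cis t) 1 \<le> \<delta> * (2 * \<delta> / ((\<delta>\<^sup>2 + t\<^sup>2) / 32))"
    using \<delta> by (intro mult_left_mono) auto
  also have "\<dots> = 64 / (1 + (t / \<delta>)\<^sup>2)"
    using \<delta> pos by (simp add: power_divide power2_eq_square divide_simps)
  finally show ?thesis .
qed

lemma poisson_mult_cis: "poisson r (cis (\<phi> + t)) (cis \<phi>) = poisson r (cis t) 1"
proof -
  have "cnj (cis (\<phi> + t)) * cis \<phi> = cnj (cis t) * 1" by (simp add: cis_cnj cis_mult)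
  then show ?thesis by (simp add: poisson_def mult.assoc)
qed

text \<open>Moving a point of the disk radially to the circle costs at most a factor 4: with |u| = r
  one has |1 - u| <= |1 - s u| + (1 - s) r <= 2 |1 - s u|.\<close>

lemma poisson_disk_le:
  assumes "norm \<zeta> = 1" "norm w = 1" "0 \<le> s" "s \<le> 1" "0 \<le> r" "r < 1"
  shows "poisson r \<zeta> (of_real s * w) \<le> 4 * poisson r \<zeta> w"
proof -
  define u where "u = of_real r * cnj \<zeta> * w"
  have nu: "norm u = r" using assms by (simp add: u_def norm_mult)
  then have "u \<noteq> 1" using assms by auto
  have "norm (1 - u) = norm ((1 - of_real s * u) - of_real (1 - s) * u)" by (simp add: algebra_simps)
  also have "\<dots> \<le> norm (1 - of_real s * u) + norm (of_real (1 - s) * u)" by (rule norm_triangle_ineq4)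
  also have "norm (of_real (1 - s) * u) = (1 - s) * r"
    unfolding norm_mult norm_of_real nu using assms by simp
  also have "(1 - s) * r \<le> 1 - s * r" using assms by (simp add: algebra_simps)
  also have "1 - s * r = norm (1::complex) - norm (of_real s * u)"
    using assms nu by (simp add: norm_mult)
  also have "\<dots> \<le> norm (1 - of_real s * u)" by (rule norm_triangle_ineq2)
  finally have le: "norm (1 - u) / 2 \<le> norm (1 - of_real s * u)" by simp
  have pos: "0 < norm (1 - u) / 2" using \<open>u \<noteq> 1\<close> by simp
  note pos' = less_le_trans[OF pos le]
  have "(norm (1 - u) / 2)\<^sup>2 \<le> (norm (1 - of_real s * u))\<^sup>2" using le pos by (intro power_mono) auto
  then have "(1 - r\<^sup>2) / (norm (1 - of_real s * u))\<^sup>2 \<le> (1 - r\<^sup>2) / (norm (1 - u) / 2)\<^sup>2"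
    using assms by (intro divide_left_mono mult_pos_pos zero_less_power pos pos') (auto simp: power_le_one)
  also have "\<dots> = 4 * ((1 - r\<^sup>2) / (norm (1 - u))\<^sup>2)" by (simp add: power_divide)
  finally show ?thesis by (simp add: poisson_def u_def mult.assoc mult.left_commute mult.commute)
qed

lemma nn_integral_inverse_1_plus_square:
  "(\<integral>\<^sup>+s. ennreal (1 / (1 + s\<^sup>2)) \<partial>lborel) = ennreal pi"
proof -
  have int: "integrable lborel (\<lambda>s::real. 1 / (1 + s\<^sup>2))"
    using integrable_inverse_1_plus_square by (simp add: set_integrable_def einterval_eq inverse_eq_divide)
  have "(LBINT s. 1 / (1 + s\<^sup>2)) = pi"
    using LBINT_inverse_1_plus_square
    by (simp add: interval_lebesgue_integral_def set_lebesgue_integral_def einterval_eq inverse_eq_divide)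
  then show ?thesis using nn_integral_eq_integral[OF int] by (simp add: add_nonneg_nonneg)
qed

lemma measurable_cis [measurable]: "cis \<in> borel_measurable borel"
  by (intro borel_measurable_continuous_onI continuous_intros)

lemma borel_measurable_cnj [measurable]: "cnj \<in> borel_measurable borel"
  by (intro borel_measurable_continuous_onI continuous_intros)

lemma borel_measurable_poisson [measurable]:
  assumes [measurable]: "f \<in> borel_measurable M" "g \<in> borel_measurable M"
  shows "(\<lambda>x. poisson r (f x) (g x)) \<in> borel_measurable M"
  unfolding poisson_def by measurable

text \<open>Substitute \<theta> = \<phi> + \<delta> s, where w = cis \<phi>. Afterwards \<delta>
  occurs only in the argument of \<open>q\<close>, and the weight is a fixed integrable
  function.\<close>

lemma nn_integral_poisson_le:
  fixes q :: "complex \<Rightarrow> ennreal"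
  assumes [measurable]: "q \<in> borel_measurable borel" and w: "norm w = 1"
    and \<delta>: "0 < \<delta>" "\<delta> \<le> 1/2"
  shows "(\<integral>\<^sup>+\<theta>. indicator {0..<2*pi} \<theta> * (q (cis \<theta>) * ennreal (poisson (1 - \<delta>) (cis \<theta>) w)) \<partial>lborel)
    \<le> (\<integral>\<^sup>+s. q (w * cis (\<delta> * s)) * ennreal (128 / (1 + s\<^sup>2)) \<partial>lborel)"
proof -
  define \<phi> where "\<phi> = Arg w"
  have w_eq: "w = cis \<phi>" unfolding \<phi>_def using w by (subst cis_Arg) (auto simp: sgn_eq)
  have \<phi>: "-pi < \<phi>" "\<phi> \<le> pi" unfolding \<phi>_def using mpi_less_Arg Arg_le_pi by auto
  define f where "f \<theta> = q (cis \<theta>) * ennreal (poisson (1 - \<delta>) (cis \<theta>) w)" for \<theta>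
  have [measurable]: "f \<in> borel_measurable borel" unfolding f_def by measurable
  define R where "R = (\<integral>\<^sup>+s. q (w * cis (\<delta> * s)) * ennreal (64 / (1 + s\<^sup>2)) \<partial>lborel)"
  \<comment> \<open>One full period centred at an argument of \<open>w\<close>, so that
    \<open>poisson_cis_le\<close> applies throughout.\<close>
  have piece: "(\<integral>\<^sup>+\<theta>. indicator {c-pi..c+pi} \<theta> * f \<theta> \<partial>lborel) \<le> R" if c: "cis c = w" for c
  proof -
    have "(\<integral>\<^sup>+\<theta>. indicator {c-pi..c+pi} \<theta> * f \<theta> \<partial>lborel)
      = ennreal \<delta> * (\<integral>\<^sup>+s. indicator {c-pi..c+pi} (c + \<delta> * s) * f (c + \<delta> * s) \<partial>lborel)"
      using nn_integral_real_affine[of "\<lambda>\<theta>. indicator {c-pi..c+pi} \<theta> * f \<theta>" \<delta> c] \<delta> by simp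
    also have "\<dots> = (\<integral>\<^sup>+s. ennreal \<delta> * (indicator {c-pi..c+pi} (c + \<delta> * s) * f (c + \<delta> * s)) \<partial>lborel)"
      by (rule nn_integral_cmult[symmetric]) measurable
    also have "\<dots> \<le> R"
      unfolding R_def
    proof (rule nn_integral_mono)
      fix s :: real
      show "ennreal \<delta> * (indicator {c-pi..c+pi} (c + \<delta> * s) * f (c + \<delta> * s))
        \<le> q (w * cis (\<delta> * s)) * ennreal (64 / (1 + s\<^sup>2))"
      proof (cases "c + \<delta> * s \<in> {c-pi..c+pi}")
        case True
        then have "\<bar>\<delta> * s\<bar> \<le> pi" by auto
        from poisson_cis_le[OF \<delta> this]
        have "\<delta> * poisson (1 - \<delta>) (cis (c + \<delta> * s)) w \<le> 64 / (1 + s\<^sup>2)"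
          using \<delta> by (simp add: c[symmetric] poisson_mult_cis)
        then have "ennreal \<delta> * ennreal (poisson (1 - \<delta>) (cis (c + \<delta> * s)) w) \<le> ennreal (64 / (1 + s\<^sup>2))"
          using \<delta> by (subst ennreal_mult''[symmetric]) (auto intro!: ennreal_leI poisson_nonneg)
        from mult_left_mono[OF this, of "q (w * cis (\<delta> * s))"]
        have "ennreal \<delta> * (q (w * cis (\<delta> * s)) * ennreal (poisson (1 - \<delta>) (cis (c + \<delta> * s)) w))
            \<le> q (w * cis (\<delta> * s)) * ennreal (64 / (1 + s\<^sup>2))"
          by (simp add: mult.left_commute)
        moreover have "cis (c + \<delta> * s) = w * cis (\<delta> * s)" by (simp add: c[symmetric] cis_mult)
        ultimately show ?thesis using True by (simp add: f_def)
      qed simp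
    qed
    finally show ?thesis .
  qed
  \<comment> \<open>The interval [0, 2 pi) need not lie in one such period, but those centred at
    \<phi> and \<phi> + 2 pi cover it. This doubles the constant 64 to 128.\<close>
  have "(\<integral>\<^sup>+\<theta>. indicator {0..<2*pi} \<theta> * f \<theta> \<partial>lborel)
    \<le> (\<integral>\<^sup>+\<theta>. indicator {\<phi>-pi..\<phi>+pi} \<theta> * f \<theta> + indicator {(\<phi>+2*pi)-pi..(\<phi>+2*pi)+pi} \<theta> * f \<theta> \<partial>lborel)"
    using \<phi> by (intro nn_integral_mono) (auto simp: indicator_def)
  also have "\<dots> = (\<integral>\<^sup>+\<theta>. indicator {\<phi>-pi..\<phi>+pi} \<theta> * f \<theta> \<partial>lborel)
      + (\<integral>\<^sup>+\<theta>. indicator {(\<phi>+2*pi)-pi..(\<phi>+2*pi)+pi} \<theta> * f \<theta> \<partial>lborel)"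
    by (rule nn_integral_add) measurable
  also have "\<dots> \<le> R + R"
    by (intro add_mono piece) (auto simp: w_eq cis_mult[symmetric])
  also have "R + R = (\<integral>\<^sup>+s. q (w * cis (\<delta> * s)) * ennreal (128 / (1 + s\<^sup>2)) \<partial>lborel)"
    unfolding R_def
    by (subst nn_integral_add[symmetric])
      (auto intro!: nn_integral_cong simp: distrib_left[symmetric] ennreal_plus[symmetric] simp del: ennreal_plus)
  finally show ?thesis by (simp add: f_def)
qed

section \<open>Fatou's theorem\<close>

lemma has_real_derivative_Re_Im_tendsto:
  fixes f :: "real \<Rightarrow> complex"
  assumes "((\<lambda>t. Re (f t)) has_real_derivative p) (at x)" "((\<lambda>t. Im (f t)) has_real_derivative q) (at x)"
  shows "((\<lambda>t. (f t - f x) / of_real (t - x)) \<longlongrightarrow> Complex p q) (at x)"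
proof -
  have "((\<lambda>t. Complex ((Re (f t) - Re (f x)) / (t - x)) ((Im (f t) - Im (f x)) / (t - x))) \<longlongrightarrow> Complex p q) (at x)"
    using assms by (intro tendsto_Complex) (auto simp: has_field_derivative_iff)
  moreover have "Complex ((Re (f t) - Re (f x)) / (t - x)) ((Im (f t) - Im (f x)) / (t - x))
      = (f t - f x) / of_real (t - x)" for t
    by (simp add: complex_eq_iff Re_divide_of_real Im_divide_of_real del: of_real_diff)
  ultimately show ?thesis by simp
qed

text \<open>Divide the difference quotient of G (cis t) in the angle by that of cis t, which tends
  to i cis \<theta>. A local inverse of \<open>cis\<close> then turns the limit in the angle into a
  limit along the circle.\<close>

lemma tendsto_circle_quotient:
  fixes G :: "complex \<Rightarrow> complex"
  assumes "((\<lambda>t. Re (G (cis t))) has_real_derivative p) (at \<theta>)"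
    "((\<lambda>t. Im (G (cis t))) has_real_derivative q) (at \<theta>)"
  shows "((\<lambda>z. (G z - G (cis \<theta>)) / (z - cis \<theta>)) \<longlongrightarrow> Complex p q / (\<i> * cis \<theta>))
    (at (cis \<theta>) within sphere 0 1)"
proof -
  define \<zeta> where "\<zeta> = cis \<theta>"
  have n\<zeta>: "norm \<zeta> = 1" by (simp add: \<zeta>_def)
  have 1: "((\<lambda>t. (G (cis t) - G \<zeta>) / of_real (t - \<theta>)) \<longlongrightarrow> Complex p q) (at \<theta>)"
    using has_real_derivative_Re_Im_tendsto[OF assms] by (simp add: \<zeta>_def)
  have "((\<lambda>t. (cis t - cis \<theta>) / of_real (t - \<theta>)) \<longlongrightarrow> Complex (- sin \<theta>) (cos \<theta>)) (at \<theta>)"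
    by (intro has_real_derivative_Re_Im_tendsto) (auto intro!: derivative_eq_intros)
  moreover have "Complex (- sin \<theta>) (cos \<theta>) = \<i> * \<zeta>" by (simp add: \<zeta>_def complex_eq_iff)
  ultimately have 2: "((\<lambda>t. (cis t - \<zeta>) / of_real (t - \<theta>)) \<longlongrightarrow> \<i> * \<zeta>) (at \<theta>)"
    by (simp only: \<zeta>_def)
  have "((\<lambda>t. ((G (cis t) - G \<zeta>) / of_real (t - \<theta>)) / ((cis t - \<zeta>) / of_real (t - \<theta>)))
      \<longlongrightarrow> Complex p q / (\<i> * \<zeta>)) (at \<theta>)"
    by (intro tendsto_divide 1 2) (simp add: \<zeta>_def)
  then have 3: "((\<lambda>t. (G (cis t) - G \<zeta>) / (cis t - \<zeta>)) \<longlongrightarrow> Complex p q / (\<i> * \<zeta>)) (at \<theta>)"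
    by (rule Lim_transform_eventually) (auto simp: eventually_at_filter)
  \<comment> \<open>A branch of the argument that is continuous at \<zeta>: the rotation by
    \<open>cnj \<zeta>\<close> puts the cut of \<open>Arg\<close> opposite to \<zeta>.\<close>
  define T where "T w = \<theta> + Arg (w * cnj \<zeta>)" for w
  have cisT: "cis (T w) = w" if "norm w = 1" for w
  proof -
    have "cis (Arg (w * cnj \<zeta>)) = w * cnj \<zeta>"
      using that n\<zeta> by (subst cis_Arg) (auto simp: norm_mult sgn_eq)
    then show ?thesis
      using n\<zeta> by (simp add: T_def cis_mult[symmetric] \<zeta>_def[symmetric] mult.left_commute[of \<zeta>] complex_norm_square[symmetric])
  qed
  have "((\<lambda>w. \<theta> + Arg (w * cnj \<zeta>)) \<longlongrightarrow> \<theta> + Arg (\<zeta> * cnj \<zeta>)) (at \<zeta> within sphere 0 1)"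
    using n\<zeta> by (intro tendsto_intros) (auto simp: complex_norm_square[symmetric])
  then have "(T \<longlongrightarrow> \<theta>) (at \<zeta> within sphere 0 1)"
    using n\<zeta> by (simp add: T_def[abs_def] complex_norm_square[symmetric])
  moreover have ev: "\<forall>\<^sub>F w in at \<zeta> within sphere 0 1. norm w = 1 \<and> w \<noteq> \<zeta>"
    by (auto simp: eventually_at_filter)
  then have "\<forall>\<^sub>F w in at \<zeta> within sphere 0 1. T w \<noteq> \<theta>"
    by eventually_elim (use cisT \<zeta>_def in auto)
  ultimately have "filterlim T (at \<theta>) (at \<zeta> within sphere 0 1)"
    by (simp add: filterlim_at)
  from filterlim_compose[OF 3 this]
  show ?thesis
    unfolding \<zeta>_def[symmetric]
    by (rule Lim_transform_eventually) (use ev cisT in \<open>auto elim!: eventually_mono\<close>)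
qed

text \<open>Cauchy's estimate is applied to G w - L w on a disk about z of radius (1 - |z|) / 2.
  There the function differs from its value at \<zeta> by |Q w| |w - \<zeta>|, and in a Stolz angle
  |w - \<zeta>| is at most a multiple of the radius, so the radius cancels.\<close>

lemma nt_limit_if_circle_differentiable:
  fixes G b :: "complex \<Rightarrow> complex"
  assumes der: "\<And>z. z \<in> ball 0 1 \<Longrightarrow> (G has_field_derivative b z) (at z)"
    and lip: "M-lipschitz_on (cball 0 1) G"
    and "((\<lambda>t. Re (G (cis t))) has_real_derivative p) (at \<theta>)"
    and "((\<lambda>t. Im (G (cis t))) has_real_derivative q) (at \<theta>)"
  shows "nt_limit b (cis \<theta>) (Complex p q / (\<i> * cis \<theta>))"
proof -
  define \<zeta> where "\<zeta> = cis \<theta>"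
  define L where "L = Complex p q / (\<i> * \<zeta>)"
  define Q where "Q z = (G z - G \<zeta>) / (z - \<zeta>) - L" for z
  have n\<zeta>: "\<zeta> \<in> sphere 0 1" by (simp add: \<zeta>_def)
  have holG: "G holomorphic_on ball 0 1"
    by (rule holomorphic_onI) (use der has_field_derivative_at_within field_differentiable_def in blast)
  have contG: "continuous_on (cball 0 1) G" using lip by (rule lipschitz_on_continuous_on)
  have "(Q \<longlongrightarrow> 0) (at \<zeta> within ball 0 1)"
  proof (rule tendsto_disk_if_tendsto_circle)
    show "Q holomorphic_on ball 0 1"
      unfolding Q_def by (intro holomorphic_intros holG) (use n\<zeta> in auto)
    show "continuous_on (cball 0 1 - {\<zeta>}) Q"
      unfolding Q_def by (intro continuous_intros continuous_on_subset[OF contG]) auto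
    have "((\<lambda>z. (G z - G \<zeta>) / (z - \<zeta>) - L) \<longlongrightarrow> L - L) (at \<zeta> within sphere 0 1)"
      using tendsto_circle_quotient[OF assms(3,4)] unfolding L_def \<zeta>_def by (rule tendsto_diff[OF _ tendsto_const])
    then show "(Q \<longlongrightarrow> 0) (at \<zeta> within sphere 0 1)" by (simp add: Q_def[abs_def])
    fix z assume z: "z \<in> cball 0 1 - {\<zeta>}"
    have "norm (G z - G \<zeta>) \<le> M * norm (z - \<zeta>)"
      using lipschitz_onD[OF lip, of z \<zeta>] z n\<zeta> by (simp add: dist_norm)
    then have "norm ((G z - G \<zeta>) / (z - \<zeta>)) \<le> M"
      using z by (simp add: norm_divide divide_le_eq)
    then show "norm (Q z) \<le> M + norm L"
      unfolding Q_def using norm_triangle_ineq4[of "(G z - G \<zeta>) / (z - \<zeta>)" L] by linarith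
  qed (rule n\<zeta>)
  note Qlim = this
  have "(b \<longlongrightarrow> L) (at \<zeta> within stolz_angle a \<zeta>)" if "a > 1" for a
  proof (rule tendstoI)
    fix e :: real assume "e > 0"
    \<comment> \<open>Cauchy's estimate below yields the bound \<open>4 * a * \<epsilon>\<close>,
      which this choice makes 2/3 of \<open>e\<close>.\<close>
    define \<epsilon> where "\<epsilon> = e / (6 * a)"
    have \<epsilon>: "\<epsilon> > 0" using \<open>e > 0\<close> \<open>a > 1\<close> by (simp add: \<epsilon>_def)
    obtain d where d: "d > 0" "\<And>w. norm w < 1 \<Longrightarrow> dist w \<zeta> < d \<Longrightarrow> norm (Q w) < \<epsilon>"
    proof -
      obtain d where "d > 0" "\<And>w. w \<in> ball 0 1 \<Longrightarrow> w \<noteq> \<zeta> \<Longrightarrow> dist w \<zeta> < d \<Longrightarrow> norm (Q w) < \<epsilon>"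
        using tendstoD[OF Qlim \<epsilon>] by (auto simp: eventually_at)
      then show ?thesis using n\<zeta> by (intro that[of d]) force+
    qed
    have "dist (b z) L < e" if z: "z \<in> stolz_angle a \<zeta>" "dist z \<zeta> < d / 2" for z
    proof -
      have nz: "norm z < 1" and za: "dist z \<zeta> < a * (1 - norm z)" using z by (auto simp: stolz_angle_def)
      \<comment> \<open>Half the distance to the circle: \<open>cball z \<rho>\<close> stays in the
        disk, and its points are at most 3/2 times as far from \<zeta> as z is.\<close>
      define \<rho> where "\<rho> = (1 - norm z) / 2"
      have \<rho>: "\<rho> > 0" using nz by (simp add: \<rho>_def)
      have "1 - norm z \<le> dist z \<zeta>"
        using norm_triangle_ineq2[of \<zeta> z] n\<zeta> by (simp add: dist_norm norm_minus_commute)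
      then have \<rho>le: "\<rho> \<le> dist z \<zeta> / 2" by (simp add: \<rho>_def)
      have near: "norm w < 1 \<and> dist w \<zeta> \<le> 3/2 * dist z \<zeta>" if "w \<in> cball z \<rho>" for w
      proof
        have "norm w \<le> norm z + \<rho>" using norm_triangle_sub[of w z] that by (simp add: dist_norm norm_minus_commute)
        then show "norm w < 1" using nz by (simp add: \<rho>_def field_simps)
        show "dist w \<zeta> \<le> 3/2 * dist z \<zeta>" using dist_triangle[of w \<zeta> z] that \<rho>le by (simp add: dist_commute)
      qed
      have "norm ((deriv ^^ 1) (\<lambda>w. G w - L * w) z) \<le> fact 1 * (4 * a * \<epsilon> * \<rho>) / \<rho> ^ 1"
      proof (rule Cauchy_higher_deriv_bound[where y="G \<zeta> - L * \<zeta>"])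
        have sub: "cball z \<rho> \<subseteq> ball 0 1" using near by auto
        show "(\<lambda>w. G w - L * w) holomorphic_on ball z \<rho>"
          using sub by (intro holomorphic_intros holomorphic_on_subset[OF holG]) auto
        show "continuous_on (cball z \<rho>) (\<lambda>w. G w - L * w)"
          using sub by (intro continuous_intros continuous_on_subset[OF contG]) auto
        fix w assume "w \<in> ball z \<rho>"
        then have w: "norm w < 1" "dist w \<zeta> \<le> 3/2 * dist z \<zeta>" using near by auto
        have "w \<noteq> \<zeta>" using w n\<zeta> by auto
        have "norm (Q w) < \<epsilon>" using d(2)[of w] w z(2) d(1) by simp
        have "norm ((G \<zeta> - L * \<zeta>) - (G w - L * w)) = norm (Q w) * dist w \<zeta>"
        proof -
          have "(G w - L * w) - (G \<zeta> - L * \<zeta>) = Q w * (w - \<zeta>)"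
            using \<open>w \<noteq> \<zeta>\<close> by (simp add: Q_def field_simps)
          then show ?thesis by (metis dist_norm norm_minus_commute norm_mult)
        qed
        also have "\<dots> \<le> \<epsilon> * (3/2 * dist z \<zeta>)"
          using \<open>norm (Q w) < \<epsilon>\<close> w \<epsilon> by (intro mult_mono) auto
        also have "\<dots> \<le> \<epsilon> * (3/2 * (a * (2 * \<rho>)))"
        proof (intro mult_left_mono)
          show "dist z \<zeta> \<le> a * (2 * \<rho>)" using za by (simp add: \<rho>_def del: right_diff_distrib_numeral)
        qed (use \<epsilon> in auto)
        also have "\<dots> < 4 * a * \<epsilon> * \<rho>" using \<epsilon> \<rho> \<open>a > 1\<close> by simp
        finally show "G w - L * w \<in> ball (G \<zeta> - L * \<zeta>) (4 * a * \<epsilon> * \<rho>)" by (simp add: dist_norm)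
      qed (use \<rho> in auto)
      moreover have "deriv (\<lambda>w. G w - L * w) z = b z - L"
        using der[of z] nz by (intro DERIV_imp_deriv) (auto intro!: derivative_eq_intros)
      ultimately have "norm (b z - L) \<le> 4 * a * \<epsilon>" using \<rho> by simp
      also have "\<dots> < e" using \<open>e > 0\<close> \<open>a > 1\<close> by (simp add: \<epsilon>_def)
      finally show ?thesis by (simp add: dist_norm)
    qed
    then show "\<forall>\<^sub>F z in at \<zeta> within stolz_angle a \<zeta>. dist (b z) L < e"
      using d(1) by (auto simp: eventually_at intro!: exI[of _ "d / 2"])
  qed
  then show ?thesis by (simp add: nt_limit_def L_def \<zeta>_def)
qed

section \<open>Points of the circle in terms of their angle\<close>

lemma norm_cis_diff_le: "norm (cis x - cis y) \<le> \<bar>x - y\<bar>"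
proof -
  have "cis x - cis y = cis y * (cis (x - y) - 1)" by (simp add: algebra_simps cis_mult)
  then have "norm (cis x - cis y) = norm (cis (x - y) - 1)" by (simp add: norm_mult)
  also have "\<dots> = 2 * \<bar>sin ((x - y) / 2)\<bar>"
    unfolding cis_conv_exp by (rule dist_exp_i_1)
  also have "\<dots> \<le> \<bar>x - y\<bar>" using abs_sin_x_le_abs_x[of "(x - y) / 2"] by simp
  finally show ?thesis .
qed

text \<open>The argument is continuous off the nonpositive real axis, a closed set on which it takes
  only the values 0 (at the origin) and pi.\<close>

lemma borel_measurable_Arg [measurable]: "Arg \<in> borel_measurable borel"
proof -
  have [measurable]: "(\<real>\<^sub>\<le>\<^sub>0 :: complex set) \<in> sets borel" by (intro borel_closed closed_nonpos_Reals_complex)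
  have "(\<lambda>z. indicator (- \<real>\<^sub>\<le>\<^sub>0) z *\<^sub>R Arg z) \<in> borel_measurable borel"
    by (intro borel_measurable_continuous_on_indicator continuous_on_Arg) auto
  then have "(\<lambda>z. if z \<in> \<real>\<^sub>\<le>\<^sub>0 then (if z = 0 then 0 else pi) else indicator (- \<real>\<^sub>\<le>\<^sub>0) z *\<^sub>R Arg z)
      \<in> borel_measurable borel" by measurable
  also have "(\<lambda>z. if z \<in> \<real>\<^sub>\<le>\<^sub>0 then (if z = 0 then 0 else pi) else indicator (- \<real>\<^sub>\<le>\<^sub>0) z *\<^sub>R Arg z) = Arg"
  proof
    fix z :: complex
    have "Arg z = pi" if "z \<in> \<real>\<^sub>\<le>\<^sub>0" "z \<noteq> 0"
      using that by (auto simp: Arg_eq_pi complex_nonpos_Reals_iff complex_eq_iff)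
    then show "(if z \<in> \<real>\<^sub>\<le>\<^sub>0 then (if z = 0 then 0 else pi) else indicator (- \<real>\<^sub>\<le>\<^sub>0) z *\<^sub>R Arg z) = Arg z"
      by (auto simp: Arg_zero)
  qed
  finally show ?thesis .
qed

lemma measurable_cis_circle:
  "cis \<in> measurable (uniform_measure lborel {0..<2 * pi}) (restrict_space borel unit_circle)"
proof (rule measurable_restrict_space2)
  show "cis \<in> borel_measurable (uniform_measure lborel {0..<2 * pi})"
    by (subst measurable_cong_sets[OF sets_uniform_measure refl]) simp
qed auto

text \<open>The circle is parametrised by [0, 2 pi), but \<open>Arg\<close> takes values in (-pi,
  pi]. For angles \<theta> > pi the argument is \<theta> - 2 pi, so the translate of the null set by
  2 pi has to be avoided as well.\<close>

lemma AE_circle_measure_Arg_notin: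
  assumes "negligible N"
  shows "AE \<zeta> in circle_measure. Arg \<zeta> \<notin> N"
proof -
  \<comment> \<open>A Borel null superset makes the predicate measurable, as
    \<open>AE_distr_iff\<close> requires.\<close>
  obtain N' where N': "N' \<in> null_sets lborel" "N \<subseteq> N'"
    using assms by (auto simp: negligible_iff_null_sets null_sets_completion_iff2)
  have [measurable]: "N' \<in> sets borel" using N'(1) by auto
  have negl: "negligible N'" using N'(1) by (simp add: negligible_iff_null_sets null_sets_completionI)
  then have "negligible (N' \<union> (+) (2 * pi) ` N')" by (intro negligible_Un negligible_translation)
  then have "AE \<theta> in lebesgue. \<theta> \<notin> N' \<union> (+) (2 * pi) ` N'"
    unfolding negligible_iff_null_sets by (rule AE_not_in)
  then have AE: "AE \<theta> in lborel. \<theta> \<notin> N' \<union> (+) (2 * pi) ` N'" by (simp only: AE_completion_iff)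
  have "AE \<zeta> in circle_measure. Arg \<zeta> \<notin> N'"
    unfolding circle_measure_def
  proof (subst AE_distr_iff[OF measurable_cis_circle])
    show "AE \<theta> in uniform_measure lborel {0..<2 * pi}. Arg (cis \<theta>) \<notin> N'"
      using AE
    proof (intro AE_uniform_measureI, simp, eventually_elim, intro impI notI)
      fix \<theta> assume \<theta>: "\<theta> \<notin> N' \<union> (+) (2 * pi) ` N'" "\<theta> \<in> {0..<2 * pi}" "Arg (cis \<theta>) \<in> N'"
      show False
      proof (cases "\<theta> \<le> pi")
        case True
        then have "Arg (cis \<theta>) = \<theta>" using \<theta>(2) by (intro Arg_cis) auto
        then show ?thesis using \<theta> by simp
      next
        case False
        then have "Arg (cis (\<theta> - 2 * pi)) = \<theta> - 2 * pi" using \<theta>(2) by (intro Arg_cis) auto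
        moreover have "cis (\<theta> - 2 * pi) = cis \<theta>" by (simp add: cis_divide[symmetric])
        ultimately have "\<theta> - 2 * pi \<in> N'" using \<theta>(3) by simp
        then have "\<theta> \<in> (+) (2 * pi) ` N'" by (intro image_eqI[of _ _ "\<theta> - 2 * pi"]) auto
        then show ?thesis using \<theta>(1) by simp
      qed
    qed
    show "{\<zeta> \<in> space (restrict_space borel unit_circle). Arg \<zeta> \<notin> N'} \<in> sets (restrict_space borel unit_circle)"
      by (intro measurable_sets_Collect[OF measurable_restrict_space1]) measurable
  qed
  then show ?thesis by eventually_elim (use N'(2) in auto)
qed

theorem Fatou_nt_limit:
  assumes b: "b \<in> Hinf_unit_ball"
  shows "AE \<zeta> in circle_measure. \<exists>L. nt_limit b \<zeta> L"
proof -
  have hol: "b holomorphic_on ball 0 1" and nb: "\<And>z. z \<in> ball 0 1 \<Longrightarrow> norm (b z) \<le> 1"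
    using b by (auto simp: Hinf_unit_ball_def)
  obtain G0 where G0: "\<And>z. z \<in> ball 0 1 \<Longrightarrow> (G0 has_field_derivative b z) (at z within ball 0 1)"
    using holomorphic_convex_primitive'[OF _ _ hol] by auto
  \<comment> \<open>The derivative of \<open>G0\<close> is bounded by 1 on a convex set. The
    Lipschitz property then gives boundary values by extension to the closure.\<close>
  have "1-lipschitz_on (ball 0 1) G0"
    using field_differentiable_bound[OF _ G0 nb] by (intro lipschitz_onI) (auto simp: dist_norm)
  then obtain G where lip: "1-lipschitz_on (cball 0 1) G" and G: "\<And>z. z \<in> ball 0 1 \<Longrightarrow> G z = G0 z"
    using lipschitz_extend_closure[of 1 "ball 0 1" G0] by auto
  have der: "(G has_field_derivative b z) (at z)" if z: "z \<in> ball 0 1" for z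
  proof -
    have "(G0 has_field_derivative b z) (at z)" using G0[OF z] z by (simp add: at_within_open[of z "ball 0 1"])
    then show ?thesis by (rule has_field_derivative_transform_within_open[OF _ open_ball z]) (use G in auto)
  qed
  have lipc: "norm (G (cis x) - G (cis y)) \<le> \<bar>x - y\<bar>" for x y
    using lipschitz_onD[OF lip, of "cis x" "cis y"] norm_cis_diff_le[of x y] by (simp add: dist_norm)
  have "\<exists>N. negligible N \<and> (\<forall>x. x \<notin> N \<longrightarrow> (\<lambda>t. Re (G (cis t))) differentiable (at x))"
    by (rule lipschitz_AE_differentiable)
      (use lipc in \<open>metis abs_Re_le_cmod minus_complex.simps(1) order_trans\<close>)
  moreover have "\<exists>N. negligible N \<and> (\<forall>x. x \<notin> N \<longrightarrow> (\<lambda>t. Im (G (cis t))) differentiable (at x))"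
    by (rule lipschitz_AE_differentiable)
      (use lipc in \<open>metis abs_Im_le_cmod minus_complex.simps(2) order_trans\<close>)
  ultimately obtain N1 N2 where N: "negligible N1" "negligible N2"
    "\<And>x. x \<notin> N1 \<Longrightarrow> (\<lambda>t. Re (G (cis t))) differentiable (at x)"
    "\<And>x. x \<notin> N2 \<Longrightarrow> (\<lambda>t. Im (G (cis t))) differentiable (at x)" by metis
  have "AE \<zeta> in circle_measure. Arg \<zeta> \<notin> N1 \<union> N2"
    using N by (intro AE_circle_measure_Arg_notin negligible_Un)
  moreover have "AE \<zeta> in circle_measure. \<zeta> \<in> unit_circle"
    by (rule AE_I2) (simp add: circle_measure_def space_restrict_space)
  ultimately show ?thesis
  proof eventually_elim
    case (elim \<zeta>)
    then have "cis (Arg \<zeta>) = \<zeta>" by (subst cis_Arg) (auto simp: sgn_eq)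
    moreover obtain p q where "((\<lambda>t. Re (G (cis t))) has_real_derivative p) (at (Arg \<zeta>))"
      "((\<lambda>t. Im (G (cis t))) has_real_derivative q) (at (Arg \<zeta>))"
      using N(3,4)[of "Arg \<zeta>"] elim(1) by (auto simp: real_differentiable_def)
    ultimately show ?case
      using nt_limit_if_circle_differentiable[OF der lip] by metis
  qed
qed

section \<open>Poisson averages of the test functions\<close>

text \<open>The limit r -> 1 is taken along the radii \<open>1 - gap n\<close>, so that Fatou's
  lemma for sequences applies. The shift by 2 gives \<open>gap n \<le> 1/2\<close>, as the Poisson
  estimates require.\<close>

definition gap :: "nat \<Rightarrow> real" where
  "gap n = 1 / (real n + 2)"

lemma gap_bounds: "0 < gap n" "gap n \<le> 1/2"
  by (auto simp: gap_def field_simps)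

lemma gap_tendsto: "gap \<longlonglongrightarrow> 0"
  unfolding gap_def[abs_def] by real_asymp

text \<open>For fixed \<open>s\<close> these are the points met in the rescaled Poisson integral.
  They are at distance \<open>gap n\<close> from the circle and at most
  \<open>(1 + \<bar>s\<bar>) * gap n\<close> from \<zeta>, so they stay in one Stolz angle. The case
  \<open>s = 0\<close> is the radial limit.\<close>

lemma nt_limit_along_curve:
  assumes lim: "nt_limit f \<zeta> v" and \<zeta>: "norm \<zeta> = 1"
  shows "(\<lambda>n. f (of_real (1 - gap n) * (\<zeta> * cis (gap n * s)))) \<longlonglongrightarrow> v"
proof -
  define x where "x n = of_real (1 - gap n) * (\<zeta> * cis (gap n * s))" for n
  have nx: "norm (x n) = 1 - gap n" for n
    unfolding x_def norm_mult norm_of_real using \<zeta> gap_bounds[of n] by simp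
  have dx: "dist (x n) \<zeta> \<le> (1 + \<bar>s\<bar>) * gap n" for n
  proof -
    have "x n - \<zeta> = \<zeta> * ((cis (gap n * s) - cis 0) - of_real (gap n) * cis (gap n * s))"
      by (simp add: x_def algebra_simps)
    then have "dist (x n) \<zeta> = norm ((cis (gap n * s) - cis 0) - of_real (gap n) * cis (gap n * s))"
      unfolding dist_norm by (simp only: norm_mult \<zeta> mult_1)
    also have "\<dots> \<le> norm (cis (gap n * s) - cis 0) + norm (of_real (gap n) * cis (gap n * s))"
      by (rule norm_triangle_ineq4)
    also have "\<dots> \<le> \<bar>gap n * s - 0\<bar> + gap n"
    proof (rule add_mono)
      show "norm (cis (gap n * s) - cis 0) \<le> \<bar>gap n * s - 0\<bar>" by (rule norm_cis_diff_le)
      show "norm (of_real (gap n) * cis (gap n * s)) \<le> gap n"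
        using gap_bounds[of n] by (simp add: norm_mult)
    qed
    also have "\<dots> = (1 + \<bar>s\<bar>) * gap n"
    proof -
      have "\<bar>t * s - 0\<bar> + t = (1 + \<bar>s\<bar>) * t" if "0 < t" for t
        using that by (simp add: abs_mult algebra_simps)
      from this[OF gap_bounds(1)] show ?thesis .
    qed
    finally show ?thesis .
  qed
  have "(\<lambda>n. (1 + \<bar>s\<bar>) * gap n) \<longlonglongrightarrow> (1 + \<bar>s\<bar>) * 0" by (intro tendsto_intros gap_tendsto)
  then have "(\<lambda>n. (1 + \<bar>s\<bar>) * gap n) \<longlonglongrightarrow> 0" by simp
  moreover have "\<forall>\<^sub>F n in sequentially. norm (dist (x n) \<zeta>) \<le> (1 + \<bar>s\<bar>) * gap n"
    using dx by simp
  ultimately have "(\<lambda>n. dist (x n) \<zeta>) \<longlonglongrightarrow> 0" by (rule Lim_null_comparison[rotated])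
  then have "x \<longlonglongrightarrow> \<zeta>" by (rule tendsto_dist_iff[THEN iffD2])
  moreover have "x n \<in> stolz_angle (2 + \<bar>s\<bar>) \<zeta> \<and> x n \<noteq> \<zeta>" for n
  proof -
    have "(1 + \<bar>s\<bar>) * gap n < (2 + \<bar>s\<bar>) * gap n"
      using gap_bounds[of n] by (intro mult_strict_right_mono) auto
    then have "dist (x n) \<zeta> < (2 + \<bar>s\<bar>) * (1 - norm (x n))" using dx[of n] nx[of n] by simp
    moreover have "norm (x n) < 1" unfolding nx using gap_bounds[of n] by simp
    ultimately show ?thesis using \<zeta> by (auto simp: stolz_angle_def)
  qed
  ultimately have x: "filterlim x (at \<zeta> within stolz_angle (2 + \<bar>s\<bar>) \<zeta>) sequentially"
    by (simp add: filterlim_at)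
  have "(f \<longlongrightarrow> v) (at \<zeta> within stolz_angle (2 + \<bar>s\<bar>) \<zeta>)"
    using lim by (simp add: nt_limit_def)
  from filterlim_compose[OF this x] show ?thesis by (simp only: x_def)
qed

text \<open>With w = r \<zeta> on a radius and v the value at z, this is 1 - |w|^2 times the squared
  modulus of the de Branges-Rovnyak kernel. The value is a separate argument because for z on the
  circle it is a non-tangential limit instead of \<open>\<beta> z\<close>.\<close>

definition test_kernel :: "(complex \<Rightarrow> complex) \<Rightarrow> real \<Rightarrow> complex \<Rightarrow> complex \<Rightarrow> complex \<Rightarrow> real" where
  "test_kernel \<beta> r \<zeta> v z = (norm (1 - cnj (\<beta> (of_real r * \<zeta>)) * v))\<^sup>2 * poisson r \<zeta> z"

lemma borel_measurable_test_kernel [measurable]: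
  assumes [measurable]: "\<beta> \<in> borel_measurable borel" "f \<in> borel_measurable M"
    "g \<in> borel_measurable M" "h \<in> borel_measurable M"
  shows "(\<lambda>x. test_kernel \<beta> r (f x) (g x) (h x)) \<in> borel_measurable M"
  unfolding test_kernel_def by measurable

lemma norm_one_minus_mult_le:
  fixes x v :: complex
  assumes "norm x \<le> 1" "norm v \<le> 1"
  shows "(norm (1 - cnj x * v))\<^sup>2 \<le> 4"
proof -
  have "norm (cnj x * v) \<le> 1 * 1" unfolding norm_mult using assms by (intro mult_mono) auto
  then have "norm (1 - cnj x * v) \<le> 2" using norm_triangle_ineq4[of 1 "cnj x * v"] by simp
  then have "(norm (1 - cnj x * v))\<^sup>2 \<le> 2\<^sup>2" by (intro power_mono) auto
  then show ?thesis by simp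
qed

context
  fixes \<beta> :: "complex \<Rightarrow> complex" and K :: "complex set"
  assumes meas [measurable]: "\<beta> \<in> borel_measurable borel" and K: "closed K"
    and bdd: "\<And>z. norm (\<beta> z) \<le> 1"
begin

text \<open>The average runs over the parameter of the kernel with z fixed; it is the inner integral
  once Fubini has exchanged the order.\<close>

definition test_integral :: "nat \<Rightarrow> complex \<Rightarrow> complex \<Rightarrow> ennreal" where
  "test_integral n v z = (\<integral>\<^sup>+\<theta>. indicator {0..<2*pi} \<theta> *
     (indicator K (cis \<theta>) * ennreal (test_kernel \<beta> (1 - gap n) (cis \<theta>) v z)) \<partial>lborel)"

text \<open>This is the majorant for the reverse Fatou lemma in z. The constant is 4 * 4 * 128 pi:
  one factor 4 from the numerator, one from moving z to the circle, and 128 pi from the integral of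
  the Poisson majorant.\<close>

lemma test_integral_le:
  assumes z: "norm z \<le> 1" and v: "norm v \<le> 1"
  shows "test_integral n v z \<le> ennreal (2048 * pi)"
proof -
  obtain s w where sw: "z = of_real s * w" "norm w = 1" "0 \<le> s" "s \<le> 1"
  proof (cases "z = 0")
    case True then show ?thesis by (intro that[of 0 1]) auto
  next
    case False then show ?thesis using z by (intro that[of "norm z" "sgn z"]) (auto simp: sgn_eq norm_divide)
  qed
  have "test_integral n v z \<le> (\<integral>\<^sup>+\<theta>. indicator {0..<2*pi} \<theta> * (16 * ennreal (poisson (1 - gap n) (cis \<theta>) w)) \<partial>lborel)"
    unfolding test_integral_def
  proof (intro nn_integral_mono mult_left_mono)
    fix \<theta>
    have "test_kernel \<beta> (1 - gap n) (cis \<theta>) v z \<le> 4 * (4 * poisson (1 - gap n) (cis \<theta>) w)"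
      unfolding test_kernel_def sw(1)
      using gap_bounds[of n] sw v bdd
      by (intro mult_mono norm_one_minus_mult_le poisson_disk_le poisson_nonneg) auto
    then have "ennreal (test_kernel \<beta> (1 - gap n) (cis \<theta>) v z) \<le> ennreal (16 * poisson (1 - gap n) (cis \<theta>) w)"
      by (intro ennreal_leI) simp
    also have "\<dots> = 16 * ennreal (poisson (1 - gap n) (cis \<theta>) w)"
      by (simp add: ennreal_mult')
    finally show "indicator K (cis \<theta>) * ennreal (test_kernel \<beta> (1 - gap n) (cis \<theta>) v z)
      \<le> 16 * ennreal (poisson (1 - gap n) (cis \<theta>) w)"
      by (auto simp: indicator_def)
  qed auto
  also have "\<dots> \<le> (\<integral>\<^sup>+s. 16 * ennreal (128 / (1 + s\<^sup>2)) \<partial>lborel)"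
    by (rule nn_integral_poisson_le[OF _ sw(2) gap_bounds]) auto
  also have "\<dots> = (\<integral>\<^sup>+s. ennreal 2048 * ennreal (1 / (1 + s\<^sup>2)) \<partial>lborel)"
    by (intro nn_integral_cong) (simp add: ennreal_mult[symmetric] flip: ennreal_numeral)
  also have "\<dots> = ennreal (2048 * pi)"
    by (simp add: nn_integral_cmult nn_integral_inverse_1_plus_square ennreal_mult)
  finally show ?thesis .
qed

text \<open>The denominator stays above (1 - |z|)^2, while 1 - r^2 is at most
  \<open>2 * gap n\<close>. Hence mass inside the disk does not contribute in the limit.\<close>

lemma test_integral_disk:
  assumes z: "norm z < 1" and v: "norm v \<le> 1"
  shows "(\<lambda>n. test_integral n v z) \<longlonglongrightarrow> 0"
proof -
  define A where "A n = 4 * (2 * gap n / (1 - norm z)\<^sup>2)" for n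
  have le: "test_integral n v z \<le> ennreal (2 * pi * A n)" for n
  proof -
    have "test_integral n v z \<le> (\<integral>\<^sup>+\<theta>. ennreal (A n) * indicator {0..<2*pi} \<theta> \<partial>lborel)"
      unfolding test_integral_def
    proof (intro nn_integral_mono)
      fix \<theta> :: real
      define r where "r = 1 - gap n"
      have r: "0 \<le> r" "r < 1" using gap_bounds[of n] by (auto simp: r_def)
      have "1 - norm z \<le> 1 - r * norm z"
        using r mult_right_mono[of r 1 "norm z"] by simp
      also have "\<dots> = norm (1::complex) - norm (of_real r * cnj (cis \<theta>) * z)"
        using r by (simp add: norm_mult)
      also have "\<dots> \<le> norm (1 - of_real r * cnj (cis \<theta>) * z)" by (rule norm_triangle_ineq2)
      finally have "(1 - norm z)\<^sup>2 \<le> (norm (1 - of_real r * cnj (cis \<theta>) * z))\<^sup>2"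
        using z by (intro power_mono) auto
      moreover have "1 - r\<^sup>2 \<le> 2 * gap n"
        by (simp add: r_def power2_eq_square algebra_simps)
      ultimately have "poisson r (cis \<theta>) z \<le> 2 * gap n / (1 - norm z)\<^sup>2"
        unfolding poisson_def using z gap_bounds[of n] by (intro frac_le) auto
      then have "test_kernel \<beta> r (cis \<theta>) v z \<le> A n"
        unfolding test_kernel_def A_def using r v bdd
        by (intro mult_mono norm_one_minus_mult_le poisson_nonneg) auto
      then show "indicator {0..<2*pi} \<theta> * (indicator K (cis \<theta>) * ennreal (test_kernel \<beta> (1 - gap n) (cis \<theta>) v z))
        \<le> ennreal (A n) * indicator {0..<2*pi} \<theta>"
        by (auto simp: indicator_def r_def intro: ennreal_leI)
    qed
    also have "\<dots> = ennreal (A n) * ennreal (2 * pi)"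
      by (subst nn_integral_cmult_indicator) auto
    also have "\<dots> = ennreal (2 * pi * A n)" by (subst ennreal_mult''[symmetric]) (auto simp: mult.commute)
    finally show ?thesis .
  qed
  have "(\<lambda>n. ennreal (2 * pi * A n)) \<longlonglongrightarrow> ennreal (2 * pi * (4 * (2 * 0 / (1 - norm z)\<^sup>2)))"
    unfolding A_def using z by (intro tendsto_intros tendsto_ennrealI gap_tendsto) auto
  then have "(\<lambda>n. ennreal (2 * pi * A n)) \<longlonglongrightarrow> 0" by simp
  then show ?thesis
    by (rule tendsto_sandwich[OF _ _ tendsto_const, rotated -1]) (use le in auto)
qed

text \<open>After rescaling, the integrand at s evaluates \<beta> along the path of
  \<open>nt_limit_along_curve\<close>, so the squared factor tends to (1 - |v|^2)^2. The reverse
  Fatou lemma applies with the majorant 512 / (1 + s^2).\<close>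

lemma test_integral_circle:
  assumes z: "norm z = 1" and v: "norm v \<le> 1" and lim: "nt_limit \<beta> z v"
  shows "limsup (\<lambda>n. test_integral n v z) \<le> ennreal (128 * pi) * (indicator K z * ennreal ((1 - (norm v)\<^sup>2)\<^sup>2))"
proof -
  have [measurable]: "K \<in> sets borel" using K by simp
  define q where "q n \<zeta> = indicator K \<zeta> * ennreal ((norm (1 - cnj (\<beta> (of_real (1 - gap n) * \<zeta>)) * v))\<^sup>2)" for n \<zeta>
  have [measurable]: "q n \<in> borel_measurable borel" for n unfolding q_def by measurable
  define u where "u n s = q n (z * cis (gap n * s)) * ennreal (128 / (1 + s\<^sup>2))" for n s
  have [measurable]: "u n \<in> borel_measurable borel" for n unfolding u_def by measurable
  have "test_integral n v z \<le> (\<integral>\<^sup>+s. u n s \<partial>lborel)" for n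
  proof -
    have "test_integral n v z = (\<integral>\<^sup>+\<theta>. indicator {0..<2*pi} \<theta> * (q n (cis \<theta>) * ennreal (poisson (1 - gap n) (cis \<theta>) z)) \<partial>lborel)"
      unfolding test_integral_def q_def test_kernel_def by (simp add: ennreal_mult' mult.assoc)
    also have "\<dots> \<le> (\<integral>\<^sup>+s. u n s \<partial>lborel)"
      unfolding u_def by (rule nn_integral_poisson_le[OF _ z gap_bounds]) measurable
    finally show ?thesis .
  qed
  then have "limsup (\<lambda>n. test_integral n v z) \<le> limsup (\<lambda>n. \<integral>\<^sup>+s. u n s \<partial>lborel)"
    by (intro Limsup_mono always_eventually) auto
  also have "\<dots> \<le> (\<integral>\<^sup>+s. limsup (\<lambda>n. u n s) \<partial>lborel)"
  proof (rule nn_integral_limsup)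
    show "AE s in lborel. u n s \<le> ennreal 512 * ennreal (1 / (1 + s\<^sup>2))" for n
    proof (rule AE_I2)
      fix s :: real
      have "q n (z * cis (gap n * s)) \<le> ennreal 4"
        using norm_one_minus_mult_le[OF bdd v]
        by (auto simp: q_def indicator_def intro!: ennreal_leI simp del: ennreal_numeral)
      then have "u n s \<le> ennreal 4 * ennreal (128 / (1 + s\<^sup>2))"
        unfolding u_def by (intro mult_right_mono) auto
      also have "\<dots> = ennreal 512 * ennreal (1 / (1 + s\<^sup>2))"
        by (simp add: ennreal_mult[symmetric] del: ennreal_numeral)
      finally show "u n s \<le> ennreal 512 * ennreal (1 / (1 + s\<^sup>2))" .
    qed
    show "(\<integral>\<^sup>+s. ennreal 512 * ennreal (1 / (1 + s\<^sup>2)) \<partial>lborel) < \<infinity>"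
      by (simp add: nn_integral_cmult nn_integral_inverse_1_plus_square ennreal_mult_less_top)
  qed auto
  also have "\<dots> \<le> (\<integral>\<^sup>+s. ennreal (128 * (1 - (norm v)\<^sup>2)\<^sup>2) * indicator K z * ennreal (1 / (1 + s\<^sup>2)) \<partial>lborel)"
  proof (rule nn_integral_mono)
    fix s :: real
    show "limsup (\<lambda>n. u n s) \<le> ennreal (128 * (1 - (norm v)\<^sup>2)\<^sup>2) * indicator K z * ennreal (1 / (1 + s\<^sup>2))"
    proof (cases "z \<in> K")
      case True
      let ?a = "\<lambda>n. ennreal ((norm (1 - cnj (\<beta> (of_real (1 - gap n) * (z * cis (gap n * s)))) * v))\<^sup>2 * (128 / (1 + s\<^sup>2)))"
      have "u n s \<le> ?a n" for n
      proof -
        have nn: "0 \<le> 128 / (1 + s\<^sup>2)" by (simp add: add_nonneg_nonneg)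
        show ?thesis
          by (cases "z * cis (gap n * s) \<in> K") (simp_all only: u_def q_def ennreal_mult''[OF nn]
            indicator_simps mult_1 mult_zero_left zero_le order_refl not_False_eq_True)
      qed
      then have "limsup (\<lambda>n. u n s) \<le> limsup ?a"
        by (intro Limsup_mono always_eventually) auto
      also have "?a \<longlonglongrightarrow> ennreal ((norm (1 - cnj v * v))\<^sup>2 * (128 / (1 + s\<^sup>2)))"
        by (intro tendsto_ennrealI tendsto_intros nt_limit_along_curve[OF lim z])
      then have "limsup ?a = ennreal ((norm (1 - cnj v * v))\<^sup>2 * (128 / (1 + s\<^sup>2)))"
        by (intro lim_imp_Limsup) auto
      also have "norm (1 - cnj v * v) = 1 - (norm v)\<^sup>2"
      proof -
        have "1 - cnj v * v = of_real (1 - (norm v)\<^sup>2)"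
          by (simp only: of_real_diff of_real_1 complex_norm_square mult.commute)
        moreover have "0 \<le> 1 - (norm v)\<^sup>2" using v by (simp add: power_le_one)
        ultimately show ?thesis by (simp only: norm_of_real abs_of_nonneg)
      qed
      also have "ennreal ((1 - (norm v)\<^sup>2)\<^sup>2 * (128 / (1 + s\<^sup>2)))
          = ennreal (128 * (1 - (norm v)\<^sup>2)\<^sup>2) * indicator K z * ennreal (1 / (1 + s\<^sup>2))"
        using True by (simp add: ennreal_mult'[symmetric] ennreal_mult''[symmetric] mult.commute)
      finally show ?thesis .
    next
      case False
      \<comment> \<open>Here closedness of \<open>K\<close> enters: the points converge to z outside
        \<open>K\<close>, hence are eventually outside \<open>K\<close>.\<close>
      have "(\<lambda>n. z * cis (gap n * s)) \<longlonglongrightarrow> z * cis (0 * s)"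
        by (intro tendsto_intros gap_tendsto)
      then have "\<forall>\<^sub>F n in sequentially. z * cis (gap n * s) \<in> - K"
        using False K by (intro topological_tendstoD) auto
      then have "\<forall>\<^sub>F n in sequentially. u n s \<le> 0"
        by eventually_elim (simp add: u_def q_def)
      then have "limsup (\<lambda>n. u n s) \<le> 0" by (rule Limsup_bounded)
      then show ?thesis by simp
    qed
  qed
  also have "\<dots> = ennreal (128 * (1 - (norm v)\<^sup>2)\<^sup>2) * indicator K z * ennreal pi"
    by (subst nn_integral_cmult) (auto simp: nn_integral_inverse_1_plus_square)
  also have "\<dots> = ennreal (128 * pi) * (indicator K z * ennreal ((1 - (norm v)\<^sup>2)\<^sup>2))"
    by (simp add: ennreal_mult' mult_ac)
  finally show ?thesis .
qed

text \<open>The hypothesis \<open>test\<close> is integrated over the angles of \<open>K\<close>.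
  Fatou's lemma handles the left-hand side; on the right, Fubini brings in
  \<open>test_integral\<close>, whose upper limits are known pointwise.\<close>

lemma integral_inequality_closed:
  fixes M :: "complex measure" and B :: "complex \<Rightarrow> complex"
  assumes sets_M [measurable_cong]: "sets M = sets borel" and fin: "finite_measure M"
    and [measurable]: "B \<in> borel_measurable borel"
    and AE_M: "AE z in M. norm z \<le> 1 \<and> norm (B z) \<le> 1 \<and> (norm z = 1 \<longrightarrow> nt_limit \<beta> z (B z))"
    and AE_l: "AE \<theta> in lborel. \<theta> \<in> {0..<2*pi} \<longrightarrow> nt_limit \<beta> (cis \<theta>) (B (cis \<theta>))"
    and test: "\<And>r \<theta>. 0 < r \<Longrightarrow> r < 1 \<Longrightarrow>
      ennreal (1 - (norm (\<beta> (of_real r * cis \<theta>)))\<^sup>2) \<le> (\<integral>\<^sup>+z. ennreal (test_kernel \<beta> r (cis \<theta>) (B z) z) \<partial>M)"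
  shows "(\<integral>\<^sup>+\<theta>. indicator {0..<2*pi} \<theta> * (indicator K (cis \<theta>) * ennreal (1 - (norm (B (cis \<theta>)))\<^sup>2)) \<partial>lborel)
    \<le> (\<integral>\<^sup>+z. ennreal (128 * pi) * (indicator (K \<inter> sphere 0 1) z * ennreal ((1 - (norm (B z))\<^sup>2)\<^sup>2)) \<partial>M)"
proof -
  have [measurable]: "K \<in> sets borel" using K by simp
  interpret M: finite_measure M by (rule fin)
  interpret P: pair_sigma_finite lborel M ..
  define L where "L n \<theta> = indicator {0..<2*pi} \<theta> * (indicator K (cis \<theta>) * ennreal (1 - (norm (\<beta> (of_real (1 - gap n) * cis \<theta>)))\<^sup>2))"
    for n \<theta>
  have [measurable]: "L n \<in> borel_measurable borel" for n unfolding L_def by measurable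
  define F where "F n \<theta> z = indicator {0..<2*pi} \<theta> * (indicator K (cis \<theta>) * ennreal (test_kernel \<beta> (1 - gap n) (cis \<theta>) (B z) z))"
    for n \<theta> z
  have F_meas [measurable]: "(\<lambda>(\<theta>, z). F n \<theta> z) \<in> borel_measurable (lborel \<Otimes>\<^sub>M M)" for n
    unfolding F_def by measurable
  have "(\<integral>\<^sup>+\<theta>. indicator {0..<2*pi} \<theta> * (indicator K (cis \<theta>) * ennreal (1 - (norm (B (cis \<theta>)))\<^sup>2)) \<partial>lborel)
      = (\<integral>\<^sup>+\<theta>. liminf (\<lambda>n. L n \<theta>) \<partial>lborel)"
  proof (intro nn_integral_cong_AE)
    show "AE \<theta> in lborel. indicator {0..<2*pi} \<theta> * (indicator K (cis \<theta>) * ennreal (1 - (norm (B (cis \<theta>)))\<^sup>2))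
      = liminf (\<lambda>n. L n \<theta>)"
      using AE_l
    proof eventually_elim
      case (elim \<theta>)
      have "(\<lambda>n. L n \<theta>) \<longlonglongrightarrow> indicator {0..<2*pi} \<theta> * (indicator K (cis \<theta>) * ennreal (1 - (norm (B (cis \<theta>)))\<^sup>2))"
      proof (cases "\<theta> \<in> {0..<2*pi} \<and> cis \<theta> \<in> K")
        case True
        then have "nt_limit \<beta> (cis \<theta>) (B (cis \<theta>))" using elim by auto
        from nt_limit_along_curve[OF this, of 0]
        have "(\<lambda>n. ennreal (1 - (norm (\<beta> (of_real (1 - gap n) * cis \<theta>)))\<^sup>2)) \<longlonglongrightarrow> ennreal (1 - (norm (B (cis \<theta>)))\<^sup>2)"
          by (intro tendsto_ennrealI tendsto_intros) simp
        then show ?thesis using True by (simp add: L_def)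
      qed (auto simp: L_def)
      then show ?case by (intro lim_imp_Liminf[symmetric]) auto
    qed
  qed
  also have "\<dots> \<le> liminf (\<lambda>n. \<integral>\<^sup>+\<theta>. L n \<theta> \<partial>lborel)"
    by (intro nn_integral_liminf) auto
  also have "\<dots> \<le> liminf (\<lambda>n. \<integral>\<^sup>+z. test_integral n (B z) z \<partial>M)"
  proof (intro Liminf_mono always_eventually allI)
    fix n
    have "(\<integral>\<^sup>+\<theta>. L n \<theta> \<partial>lborel) \<le> (\<integral>\<^sup>+\<theta>. (\<integral>\<^sup>+z. F n \<theta> z \<partial>M) \<partial>lborel)"
    proof (intro nn_integral_mono)
      fix \<theta> :: real
      have "ennreal (1 - (norm (\<beta> (of_real (1 - gap n) * cis \<theta>)))\<^sup>2)
        \<le> (\<integral>\<^sup>+z. ennreal (test_kernel \<beta> (1 - gap n) (cis \<theta>) (B z) z) \<partial>M)"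
        using gap_bounds[of n] by (intro test) linarith+
      then show "L n \<theta> \<le> (\<integral>\<^sup>+z. F n \<theta> z \<partial>M)"
        unfolding L_def F_def by (auto simp: indicator_def)
    qed
    also have "\<dots> = (\<integral>\<^sup>+z. (\<integral>\<^sup>+\<theta>. F n \<theta> z \<partial>lborel) \<partial>M)"
      by (rule P.Fubini'[OF F_meas, symmetric])
    finally show "(\<integral>\<^sup>+\<theta>. L n \<theta> \<partial>lborel) \<le> (\<integral>\<^sup>+z. test_integral n (B z) z \<partial>M)"
      by (simp add: test_integral_def F_def)
  qed
  \<comment> \<open>The upper limit admits the reverse Fatou lemma; the constant of
    \<open>test_integral_le\<close> is integrable because \<open>M\<close> is finite.\<close>
  also have "\<dots> \<le> limsup (\<lambda>n. \<integral>\<^sup>+z. test_integral n (B z) z \<partial>M)"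
    by (intro Liminf_le_Limsup) auto
  also have "\<dots> \<le> (\<integral>\<^sup>+z. limsup (\<lambda>n. test_integral n (B z) z) \<partial>M)"
  proof (rule nn_integral_limsup)
    show "(\<lambda>z. test_integral n (B z) z) \<in> borel_measurable M" for n
      using lborel.borel_measurable_nn_integral[of "\<lambda>z \<theta>. F n \<theta> z" M]
      unfolding test_integral_def F_def by measurable
    show "AE z in M. test_integral n (B z) z \<le> ennreal (2048 * pi)" for n
      using AE_M by eventually_elim (auto intro: test_integral_le)
    have "emeasure M (space M) < top"
      using M.emeasure_finite[of "space M"] by (simp only: infinity_ennreal_def less_top)
    then show "(\<integral>\<^sup>+z. ennreal (2048 * pi) \<partial>M) < \<infinity>"
      by (simp add: ennreal_mult_less_top)
  qed auto
  also have "\<dots> \<le> (\<integral>\<^sup>+z. ennreal (128 * pi) * (indicator (K \<inter> sphere 0 1) z * ennreal ((1 - (norm (B z))\<^sup>2)\<^sup>2)) \<partial>M)"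
  proof (rule nn_integral_mono_AE)
    show "AE z in M. limsup (\<lambda>n. test_integral n (B z) z)
      \<le> ennreal (128 * pi) * (indicator (K \<inter> sphere 0 1) z * ennreal ((1 - (norm (B z))\<^sup>2)\<^sup>2))"
      using AE_M
    proof eventually_elim
      case (elim z)
      show ?case
      proof (cases "norm z = 1")
        case True
        then show ?thesis using test_integral_circle[OF True, of "B z"] elim by (simp add: indicator_inter_arith)
      next
        case False
        then have "limsup (\<lambda>n. test_integral n (B z) z) = 0"
          using test_integral_disk[of z "B z"] elim by (intro lim_imp_Limsup) auto
        then show ?thesis by simp
      qed
    qed
  qed
  finally show ?thesis .
qed

end

section \<open>Non-tangential limits and kernel functions\<close>

text \<open>The radial points (1 - t) \<zeta> are equally far from \<zeta> and from the circle, so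
  they lie in every Stolz angle. This makes non-tangential limits unique.\<close>

lemma stolz_nontrivial:
  assumes "norm \<zeta> = 1" "1 < a"
  shows "at \<zeta> within stolz_angle a \<zeta> \<noteq> bot"
proof -
  have "\<zeta> islimpt stolz_angle a \<zeta>"
    unfolding islimpt_approachable
  proof (intro allI impI)
    fix e :: real assume "0 < e"
    define t where "t = min (e / 2) (1 / 2)"
    have t: "0 < t" "t < e" "t \<le> 1/2" using \<open>0 < e\<close> by (auto simp: t_def)
    define x where "x = of_real (1 - t) * \<zeta>"
    have "norm x = 1 - t" unfolding x_def norm_mult norm_of_real using t assms by simp
    moreover have "dist x \<zeta> = t"
    proof -
      have "x - \<zeta> = - (of_real t * \<zeta>)" by (simp add: x_def algebra_simps)
      then show ?thesis using t assms by (simp add: dist_norm norm_mult)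
    qed
    ultimately have "x \<in> stolz_angle a \<zeta> \<and> x \<noteq> \<zeta> \<and> dist x \<zeta> < e"
      using t assms by (auto simp: stolz_angle_def)
    then show "\<exists>x'\<in>stolz_angle a \<zeta>. x' \<noteq> \<zeta> \<and> dist x' \<zeta> < e" by blast
  qed
  then show ?thesis by (simp add: trivial_limit_within)
qed

lemma nt_limit_unique:
  assumes "norm \<zeta> = 1" "nt_limit f \<zeta> L" "nt_limit f \<zeta> L'"
  shows "L = L'"
proof (rule tendsto_unique)
  show "at \<zeta> within stolz_angle 2 \<zeta> \<noteq> bot" using assms by (intro stolz_nontrivial) auto
  show "(f \<longlongrightarrow> L) (at \<zeta> within stolz_angle 2 \<zeta>)" "(f \<longlongrightarrow> L') (at \<zeta> within stolz_angle 2 \<zeta>)"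
    using assms by (simp_all add: nt_limit_def)
qed

lemma nt_ext_eq:
  assumes "norm \<zeta> = 1" "nt_limit f \<zeta> L"
  shows "nt_ext f \<zeta> = L"
proof -
  have "(THE L. nt_limit f \<zeta> L) = L"
    using assms(2) by (rule the_equality) (rule nt_limit_unique[OF assms(1) _ assms(2)])
  then show ?thesis using assms by (auto simp: nt_ext_def)
qed

lemma nt_limit_cong:
  assumes "\<And>z. norm z < 1 \<Longrightarrow> f z = g z" "nt_limit f \<zeta> L"
  shows "nt_limit g \<zeta> L"
  unfolding nt_limit_def
proof (intro allI impI)
  fix a :: real assume "1 < a"
  then have "(f \<longlongrightarrow> L) (at \<zeta> within stolz_angle a \<zeta>)" using assms(2) by (simp add: nt_limit_def)
  then show "(g \<longlongrightarrow> L) (at \<zeta> within stolz_angle a \<zeta>)"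
    by (rule Lim_transform_eventually)
      (auto simp: eventually_at_filter stolz_angle_def assms(1))
qed

lemma norm_nt_limit_le:
  assumes "norm \<zeta> = 1" "nt_limit f \<zeta> L" "\<And>z. norm z < 1 \<Longrightarrow> norm (f z) \<le> c"
  shows "norm L \<le> c"
proof (rule tendsto_upperbound[OF tendsto_norm])
  show "(f \<longlongrightarrow> L) (at \<zeta> within stolz_angle 2 \<zeta>)" using assms by (simp add: nt_limit_def)
  show "at \<zeta> within stolz_angle 2 \<zeta> \<noteq> bot" using assms by (intro stolz_nontrivial) auto
  show "\<forall>\<^sub>F z in at \<zeta> within stolz_angle 2 \<zeta>. norm (f z) \<le> c"
    by (auto simp: eventually_at_filter stolz_angle_def intro!: always_eventually assms(3))
qed

lemma dBR_kernel_diagonal: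
  "dBR_kernel b w w = of_real ((1 - (norm (b w))\<^sup>2) / (1 - (norm w)\<^sup>2))"
  by (simp add: dBR_kernel_def mult.commute complex_norm_square[symmetric] flip: of_real_power)

lemma nt_limit_dBR_kernel:
  assumes "norm w < 1" "norm \<zeta> = 1" "nt_limit b \<zeta> L"
  shows "nt_limit (\<lambda>z. if z \<in> unit_disk then dBR_kernel b w z else 0) \<zeta> ((1 - cnj (b w) * L) / (1 - cnj w * \<zeta>))"
proof (rule nt_limit_cong)
  have "norm (cnj w * \<zeta>) < 1" using assms by (simp add: norm_mult)
  then have "1 - cnj w * \<zeta> \<noteq> 0" by auto
  then show "nt_limit (\<lambda>z. (1 - cnj (b w) * b z) / (1 - cnj w * z)) \<zeta> ((1 - cnj (b w) * L) / (1 - cnj w * \<zeta>))"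
    using assms(3) unfolding nt_limit_def by (auto intro!: tendsto_intros)
qed (simp add: dBR_kernel_def)

text \<open>The inequality is tested on the kernel function at \<open>w\<close>. Its squared norm is
  its value at \<open>w\<close> by the reproducing property, and it is admissible because its
  non-tangential limits come from those of \<open>b\<close>.\<close>

lemma reverse_Carleson_kernel:
  assumes \<mu>: "finite_borel_measure_on_closed_disk \<mu>" and b: "b \<in> Hinf_unit_ball"
    and adm: "admissible \<mu> b" and H: "de_Branges_Rovnyak b H ip" and "0 < C"
    and C: "\<And>f. f \<in> admissible_part \<mu> H \<Longrightarrow> ennreal (hnorm ip f) \<le> ennreal C * L2_norm \<mu> f"
    and w: "norm w < 1"
  shows "ennreal ((1 - (norm (b w))\<^sup>2) / (1 - (norm w)\<^sup>2))
    \<le> ennreal (C\<^sup>2) * (\<integral>\<^sup>+z. ennreal ((norm ((1 - cnj (b w) * nt_ext b z) / (1 - cnj w * z)))\<^sup>2) \<partial>\<mu>)"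
proof -
  interpret rkhs unit_disk "dBR_kernel b" H ip using H by (simp add: de_Branges_Rovnyak_def)
  define k where "k z = (if z \<in> unit_disk then dBR_kernel b w z else 0)" for z
  have space: "space \<mu> = cball 0 1"
    using \<mu> by (auto simp: finite_borel_measure_on_closed_disk_def space_restrict_space dest: sets_eq_imp_space_eq)
  have kH: "k \<in> H" unfolding k_def using w by (intro kernel_mem) auto
  have AEb: "AE z in \<mu>. z \<in> unit_circle \<longrightarrow> (\<exists>L. nt_limit b z L)" using adm by (simp add: admissible_def)
  have klim: "nt_limit k z ((1 - cnj (b w) * L) / (1 - cnj w * z))" if "norm z = 1" "nt_limit b z L" for z L
    unfolding k_def by (rule nt_limit_dBR_kernel[OF w that])
  have "admissible \<mu> k"
    unfolding admissible_def
  proof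
    show "k holomorphic_on unit_disk" using H kH by (simp add: de_Branges_Rovnyak_def)
    show "AE z in \<mu>. z \<in> unit_circle \<longrightarrow> (\<exists>L. nt_limit k z L)"
      using AEb by eventually_elim (use klim in fastforce)
  qed
  then have "ennreal (hnorm ip k) \<le> ennreal C * L2_norm \<mu> k" using kH by (intro C) (simp add: admissible_part_def)
  define I where "I = (\<integral>\<^sup>+z. ennreal ((norm ((1 - cnj (b w) * nt_ext b z) / (1 - cnj w * z)))\<^sup>2) \<partial>\<mu>)"
  have I_eq: "(\<integral>\<^sup>+z. ennreal ((norm (nt_ext k z))\<^sup>2) \<partial>\<mu>) = I"
    unfolding I_def
  proof (rule nn_integral_cong_AE)
    have "AE z in \<mu>. z \<in> cball 0 1" using space by (intro AE_I2) auto
    with AEb show "AE z in \<mu>. ennreal ((norm (nt_ext k z))\<^sup>2) = ennreal ((norm ((1 - cnj (b w) * nt_ext b z) / (1 - cnj w * z)))\<^sup>2)"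
    proof eventually_elim
      case (elim z)
      show ?case
      proof (cases "norm z < 1")
        case True
        then show ?thesis by (simp add: nt_ext_def k_def dBR_kernel_def)
      next
        case False
        then have z: "norm z = 1" using elim by auto
        then obtain L where L: "nt_limit b z L" using elim by auto
        show ?thesis using nt_ext_eq[OF z L] nt_ext_eq[OF z klim[OF z L]] by simp
      qed
    qed
  qed
  have kk: "Re (ip k k) = (1 - (norm (b w))\<^sup>2) / (1 - (norm w)\<^sup>2)"
  proof -
    have "k w = ip k k" unfolding k_def using reproducing[of k w] kH w by (simp add: k_def[abs_def])
    moreover have "k w = of_real ((1 - (norm (b w))\<^sup>2) / (1 - (norm w)\<^sup>2))"
      using w dBR_kernel_diagonal[of b w] by (simp add: k_def)
    ultimately show ?thesis by (metis Re_complex_of_real)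
  qed
  show ?thesis
    unfolding I_def[symmetric]
  proof (cases "I = \<infinity>")
    \<comment> \<open>With an infinite integral the right-hand side is infinite because
      \<open>C\<close> is positive. Otherwise the inequality of norms is squared.\<close>
    case True
    then show "ennreal ((1 - (norm (b w))\<^sup>2) / (1 - (norm w)\<^sup>2)) \<le> ennreal (C\<^sup>2) * I"
      using \<open>0 < C\<close> by (simp add: ennreal_mult_top)
  next
    case False
    then have "L2_norm \<mu> k = ennreal (sqrt (enn2real I))" by (simp add: L2_norm_def I_eq)
    then have "ennreal (hnorm ip k) \<le> ennreal (C * sqrt (enn2real I))"
      using \<open>ennreal (hnorm ip k) \<le> ennreal C * L2_norm \<mu> k\<close> \<open>0 < C\<close> by (simp add: ennreal_mult)
    then have "hnorm ip k \<le> C * sqrt (enn2real I)"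
      using \<open>0 < C\<close> by (subst (asm) ennreal_le_iff) auto
    then have "(hnorm ip k)\<^sup>2 \<le> (C * sqrt (enn2real I))\<^sup>2"
      using ip_nonneg[OF kH] by (intro power_mono) (auto simp: hnorm_def)
    then have "(1 - (norm (b w))\<^sup>2) / (1 - (norm w)\<^sup>2) \<le> C\<^sup>2 * enn2real I"
      using ip_nonneg[OF kH] by (simp add: hnorm_def kk power_mult_distrib)
    then have "ennreal ((1 - (norm (b w))\<^sup>2) / (1 - (norm w)\<^sup>2)) \<le> ennreal (C\<^sup>2 * enn2real I)"
      by (rule ennreal_leI)
    also have "\<dots> = ennreal (C\<^sup>2) * I" using False by (simp add: ennreal_mult less_top)
    finally show "ennreal ((1 - (norm (b w))\<^sup>2) / (1 - (norm w)\<^sup>2)) \<le> ennreal (C\<^sup>2) * I" .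
  qed
qed

lemma nn_integral_circle_measure:
  assumes [measurable]: "f \<in> borel_measurable borel"
  shows "(\<integral>\<^sup>+\<zeta>. f \<zeta> \<partial>circle_measure)
    = (\<integral>\<^sup>+\<theta>. indicator {0..<2*pi} \<theta> * f (cis \<theta>) \<partial>lborel) / ennreal (2 * pi)"
proof -
  have "(\<integral>\<^sup>+\<zeta>. f \<zeta> \<partial>circle_measure) = (\<integral>\<^sup>+\<theta>. f (cis \<theta>) \<partial>uniform_measure lborel {0..<2*pi})"
    unfolding circle_measure_def
    by (rule nn_integral_distr[OF measurable_cis_circle]) (simp add: measurable_restrict_space1)
  also have "\<dots> = (\<integral>\<^sup>+\<theta>. f (cis \<theta>) * indicator {0..<2*pi} \<theta> \<partial>lborel) / emeasure lborel {0..<2*pi}"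
    by (rule nn_integral_uniform_measure) measurable
  finally show ?thesis by (simp add: mult.commute)
qed

lemma AE_circle_measureD:
  assumes "AE \<zeta> in circle_measure. P \<zeta>"
  shows "AE \<theta> in lborel. \<theta> \<in> {0..<2*pi} \<longrightarrow> P (cis \<theta>)"
proof -
  have "AE \<theta> in uniform_measure lborel {0..<2*pi}. P (cis \<theta>)"
    using AE_distrD[OF measurable_cis_circle] assms unfolding circle_measure_def by blast
  then show ?thesis by (subst (asm) AE_uniform_measure) auto
qed

section \<open>From integral inequalities to densities\<close>

text \<open>The measure with density \<open>f\<close> is finite on a Polish space, hence inner
  regular: its value on \<open>A\<close> is the supremum over compact subsets, to which the closed
  case applies.\<close>

lemma nn_integral_le_if_le_closed:
  fixes M N :: "'a::{second_countable_topology, complete_space} measure"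
  assumes id: "(\<lambda>x. x) \<in> measurable M borel" and f [measurable]: "f \<in> borel_measurable M"
    and fin: "(\<integral>\<^sup>+x. f x \<partial>M) < \<infinity>"
    and le: "\<And>K. closed K \<Longrightarrow> (\<integral>\<^sup>+x. indicator K x * f x \<partial>M) \<le> (\<integral>\<^sup>+x. indicator K x * g x \<partial>N)"
    and A: "A \<in> sets borel"
  shows "(\<integral>\<^sup>+x. indicator A x * f x \<partial>M) \<le> (\<integral>\<^sup>+x. indicator A x * g x \<partial>N)"
proof -
  \<comment> \<open>\<open>M\<close> may live on a subspace such as the circle; its image under the
    identity is a measure on all Borel sets.\<close>
  define N1 where "N1 = distr (density M f) borel (\<lambda>x. x)"
  have em: "emeasure N1 X = (\<integral>\<^sup>+x. indicator X x * f x \<partial>M)" if X [measurable]: "X \<in> sets borel" for X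
  proof -
    have X': "(\<lambda>x. x) -` X \<inter> space M \<in> sets M" using id X by (rule measurable_sets)
    have "emeasure N1 X = emeasure (density M f) ((\<lambda>x. x) -` X \<inter> space (density M f))"
      unfolding N1_def by (rule emeasure_distr) (use id in auto)
    also have "\<dots> = (\<integral>\<^sup>+x. f x * indicator ((\<lambda>x. x) -` X \<inter> space M) x \<partial>M)"
      using X' by (simp add: emeasure_density)
    also have "\<dots> = (\<integral>\<^sup>+x. indicator X x * f x \<partial>M)"
      by (intro nn_integral_cong) (auto simp: indicator_def)
    finally show ?thesis .
  qed
  have "emeasure N1 (space N1) < \<infinity>"
    using em[of UNIV] fin by (simp add: N1_def)
  then have "emeasure N1 A = (SUP K\<in>{K. K \<subseteq> A \<and> compact K}. emeasure N1 K)"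
    by (intro inner_regular) (use A in \<open>auto simp: N1_def\<close>)
  also have "\<dots> \<le> (\<integral>\<^sup>+x. indicator A x * g x \<partial>N)"
  proof (rule SUP_least)
    fix K assume K: "K \<in> {K. K \<subseteq> A \<and> compact K}"
    then have "closed K" by (auto intro: compact_imp_closed)
    then have "emeasure N1 K \<le> (\<integral>\<^sup>+x. indicator K x * g x \<partial>N)" using le em[of K] by simp
    also have "\<dots> \<le> (\<integral>\<^sup>+x. indicator A x * g x \<partial>N)"
      using K by (intro nn_integral_mono mult_right_mono) (auto simp: indicator_def)
    finally show "emeasure N1 K \<le> (\<integral>\<^sup>+x. indicator A x * g x \<partial>N)" .
  qed
  finally show ?thesis using em[OF A] by simp
qed

text \<open>Off a null set \<open>N\<close> carrying the singular part, \<nu> coincides with its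
  absolutely continuous part. The Radon-Nikodym derivative of the latter is finite almost
  everywhere, so its real version \<open>ac_deriv\<close> may replace it.\<close>

lemma nn_integral_ac_deriv:
  assumes M: "finite_measure M" and \<nu>: "finite_measure \<nu>" and sets: "sets \<nu> = sets M"
  obtains N where "N \<in> null_sets M"
    "\<And>A g. A \<in> sets M \<Longrightarrow> A \<inter> N = {} \<Longrightarrow> g \<in> borel_measurable M \<Longrightarrow>
      (\<integral>\<^sup>+x. indicator A x * g x \<partial>\<nu>) = (\<integral>\<^sup>+x. indicator A x * (ennreal (ac_deriv M \<nu> x) * g x) \<partial>M)"
proof -
  interpret M: finite_measure M by (rule M)
  interpret \<nu>: finite_measure \<nu> by (rule \<nu>)
  define \<alpha> where "\<alpha> = ac_part M \<nu>"
  obtain \<sigma> where "lebesgue_decomposition M \<nu> \<alpha> \<sigma>"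
    using lebesgue_decomposition_ac_part[OF \<nu> sets] by (auto simp: \<alpha>_def)
  then obtain N where s\<alpha>: "sets \<alpha> = sets M" and s\<sigma>: "sets \<sigma> = sets M"
    and dec: "\<And>A. A \<in> sets M \<Longrightarrow> emeasure \<nu> A = emeasure \<alpha> A + emeasure \<sigma> A"
    and ac: "absolutely_continuous M \<alpha>" and N: "N \<in> null_sets M" "emeasure \<sigma> (space M - N) = 0"
    by (auto simp: lebesgue_decomposition_def)
  have sp: "space \<alpha> = space M" "space \<nu> = space M" using s\<alpha> sets by (auto dest: sets_eq_imp_space_eq)
  have "emeasure \<alpha> (space \<alpha>) \<le> emeasure \<nu> (space \<nu>)" using dec[of "space M"] sp by simp
  then have "finite_measure \<alpha>"
    using \<nu>.emeasure_finite[of "space \<nu>"] by (intro finite_measureI) (auto simp: top_unique)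
  then have "sigma_finite_measure \<alpha>" by (rule finite_measure.axioms)
  then have RNfin: "AE x in M. RN_deriv M \<alpha> x \<noteq> \<infinity>"
    by (rule M.RN_deriv_finite[OF _ ac s\<alpha>])
  have "(\<integral>\<^sup>+x. indicator A x * g x \<partial>\<nu>) = (\<integral>\<^sup>+x. indicator A x * (ennreal (ac_deriv M \<nu> x) * g x) \<partial>M)"
    if A [measurable]: "A \<in> sets M" and AN: "A \<inter> N = {}" and g [measurable]: "g \<in> borel_measurable M" for A g
  proof -
    have g' : "g \<in> borel_measurable \<nu>" "g \<in> borel_measurable \<alpha>"
      unfolding measurable_cong_sets[OF sets refl] measurable_cong_sets[OF s\<alpha> refl] by (rule g)+
    have A': "A \<in> sets \<nu>" "A \<in> sets \<alpha>" using A sets s\<alpha> by auto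
    \<comment> \<open>Since \<open>A\<close> avoids \<open>N\<close>, the singular part \<sigma>
      gives no mass to subsets of \<open>A\<close>.\<close>
    have "density \<nu> (indicator A) = density \<alpha> (indicator A)"
    proof (rule measure_eqI)
      fix X assume "X \<in> sets (density \<nu> (indicator A))"
      then have X: "X \<in> sets M" using sets by simp
      have "emeasure \<sigma> (A \<inter> X) \<le> emeasure \<sigma> (space M - N)"
        using A X AN N sets.sets_into_space[OF A] s\<sigma> by (intro emeasure_mono) auto
      then have "emeasure \<nu> (A \<inter> X) = emeasure \<alpha> (A \<inter> X)" using dec[of "A \<inter> X"] A X N(2) by simp
      then show "emeasure (density \<nu> (indicator A)) X = emeasure (density \<alpha> (indicator A)) X"
        using A' X sets s\<alpha> by (simp add: emeasure_restricted)
    qed (simp add: sets s\<alpha>)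
    then have "(\<integral>\<^sup>+x. g x \<partial>density \<nu> (indicator A)) = (\<integral>\<^sup>+x. g x \<partial>density \<alpha> (indicator A))" by simp
    then have "(\<integral>\<^sup>+x. indicator A x * g x \<partial>\<nu>) = (\<integral>\<^sup>+x. indicator A x * g x \<partial>\<alpha>)"
      using A' g' by (simp add: nn_integral_density)
    also have "\<dots> = (\<integral>\<^sup>+x. RN_deriv M \<alpha> x * (indicator A x * g x) \<partial>M)"
      by (rule M.RN_deriv_nn_integral[OF ac s\<alpha>]) measurable
    also have "\<dots> = (\<integral>\<^sup>+x. indicator A x * (ennreal (ac_deriv M \<nu> x) * g x) \<partial>M)"
      using RNfin
      by (intro nn_integral_cong_AE, eventually_elim) (simp add: ac_deriv_def \<alpha>_def less_top mult.left_commute)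
    finally show ?thesis .
  qed
  with N(1) show ?thesis by (rule that)
qed

text \<open>Integrate over the set where the inequality fails, with a null set carrying the singular
  part removed. The hypothesis forces the integral of the positive difference of the two sides to
  vanish there.\<close>

lemma AE_le_ac_deriv:
  fixes F :: "'a \<Rightarrow> real"
  assumes M: "finite_measure M" and \<nu>: "finite_measure \<nu>" and sets: "sets \<nu> = sets M"
    and F [measurable]: "F \<in> borel_measurable M" and F1: "\<And>x. F x \<le> 1" and "0 \<le> c"
    and le: "\<And>A. A \<in> sets M \<Longrightarrow>
      (\<integral>\<^sup>+x. indicator A x * ennreal (F x) \<partial>M) \<le> (\<integral>\<^sup>+x. indicator A x * ennreal (c * (F x)\<^sup>2) \<partial>\<nu>)"
  shows "AE x in M. F x \<le> c * (F x)\<^sup>2 * ac_deriv M \<nu> x"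
proof -
  interpret M: finite_measure M by (rule M)
  obtain N where N: "N \<in> null_sets M" and int: "\<And>A g. A \<in> sets M \<Longrightarrow> A \<inter> N = {} \<Longrightarrow> g \<in> borel_measurable M \<Longrightarrow>
      (\<integral>\<^sup>+x. indicator A x * g x \<partial>\<nu>) = (\<integral>\<^sup>+x. indicator A x * (ennreal (ac_deriv M \<nu> x) * g x) \<partial>M)"
    by (rule nn_integral_ac_deriv[OF M \<nu> sets]) (rule that)
  define G where "G x = c * (F x)\<^sup>2 * ac_deriv M \<nu> x" for x
  have [measurable]: "ac_deriv M \<nu> \<in> borel_measurable M" unfolding ac_deriv_def[abs_def] by measurable
  have [measurable]: "G \<in> borel_measurable M" unfolding G_def[abs_def] by measurable
  have G0: "0 \<le> G x" for x using \<open>0 \<le> c\<close> by (simp add: G_def ac_deriv_def)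
  define A where "A = {x \<in> space M. G x < F x} - N"
  have N_sets [measurable]: "N \<in> sets M" using N by auto
  have A [measurable]: "A \<in> sets M" unfolding A_def by measurable
  have "(\<integral>\<^sup>+x. indicator A x * ennreal (F x) \<partial>M) = (\<integral>\<^sup>+x. indicator A x * ennreal (G x) + indicator A x * ennreal (F x - G x) \<partial>M)"
    using G0 by (intro nn_integral_cong)
      (auto simp: A_def indicator_def ennreal_plus[symmetric] simp del: ennreal_plus)
  also have "\<dots> = (\<integral>\<^sup>+x. indicator A x * ennreal (G x) \<partial>M) + (\<integral>\<^sup>+x. indicator A x * ennreal (F x - G x) \<partial>M)"
    by (rule nn_integral_add) measurable
  finally have split: "(\<integral>\<^sup>+x. indicator A x * ennreal (F x) \<partial>M) = \<dots>" .
  have "(\<integral>\<^sup>+x. indicator A x * ennreal (F x) \<partial>M) \<le> (\<integral>\<^sup>+x. indicator A x * ennreal (c * (F x)\<^sup>2) \<partial>\<nu>)"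
    by (rule le[OF A])
  also have "\<dots> = (\<integral>\<^sup>+x. indicator A x * (ennreal (ac_deriv M \<nu> x) * ennreal (c * (F x)\<^sup>2)) \<partial>M)"
    by (rule int) (auto simp: A_def)
  also have "\<dots> = (\<integral>\<^sup>+x. indicator A x * ennreal (G x) \<partial>M)"
    using \<open>0 \<le> c\<close> by (intro nn_integral_cong) (simp add: G_def ac_deriv_def ennreal_mult'' mult.commute)
  finally have X: "(\<integral>\<^sup>+x. indicator A x * ennreal (G x) \<partial>M) + (\<integral>\<^sup>+x. indicator A x * ennreal (F x - G x) \<partial>M)
    \<le> (\<integral>\<^sup>+x. indicator A x * ennreal (G x) \<partial>M) + 0" unfolding split by simp
  \<comment> \<open>Cancelling this term from both sides requires it to be finite; on
    \<open>A\<close> one has 0 <= G < F <= 1.\<close>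
  have "(\<integral>\<^sup>+x. indicator A x * ennreal (G x) \<partial>M) \<le> (\<integral>\<^sup>+x. 1 \<partial>M)"
  proof (rule nn_integral_mono)
    fix x show "indicator A x * ennreal (G x) \<le> 1"
      using F1[of x] by (auto simp: A_def indicator_def ennreal_le_1)
  qed
  also have "\<dots> = emeasure M (space M)" by simp
  also have "\<dots> < top" using M.emeasure_finite[of "space M"] by (simp only: infinity_ennreal_def less_top)
  finally have "(\<integral>\<^sup>+x. indicator A x * ennreal (G x) \<partial>M) \<noteq> top" by (simp only: less_top)
  with X have "(\<integral>\<^sup>+x. indicator A x * ennreal (F x - G x) \<partial>M) = 0"
    unfolding ennreal_add_left_cancel_le infinity_ennreal_def le_zero_eq by blast
  then have "AE x in M. indicator A x * ennreal (F x - G x) = 0"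
    by (subst (asm) nn_integral_0_iff_AE) auto
  moreover have "AE x in M. x \<notin> N" using N by (rule AE_not_in)
  moreover have "AE x in M. x \<in> space M" by (rule AE_space)
  ultimately show ?thesis
  proof eventually_elim
    case (elim x)
    show ?case
    proof (rule ccontr)
      assume "\<not> ?thesis"
      then have "G x < F x" by (simp add: G_def)
      with elim(1) elim(2,3) show False by (simp add: A_def)
    qed
  qed
qed

text \<open>The library rule for \<open>distr\<close> requires a measurable predicate, which the existence of
  non-tangential limits is not known to be.\<close>

lemma AE_distr_borelI:
  fixes \<mu> :: "complex measure"
  assumes sets: "sets \<mu> = sets (restrict_space borel (cball 0 1))" and P: "AE z in \<mu>. P z"
  shows "AE z in distr \<mu> borel (\<lambda>z. z). P z"
proof -
  have id: "(\<lambda>z. z) \<in> measurable \<mu> borel"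
    by (subst measurable_cong_sets[OF sets refl]) (intro measurable_restrict_space1, simp)
  have space: "space \<mu> = cball 0 1" using sets by (auto simp: space_restrict_space dest: sets_eq_imp_space_eq)
  \<comment> \<open>Membership in the closed disk minus the measurable null set \<open>N\<close> is
    a measurable predicate, and it implies \<open>P\<close>.\<close>
  obtain N where N: "{z \<in> space \<mu>. \<not> P z} \<subseteq> N" "emeasure \<mu> N = 0" "N \<in> sets \<mu>"
    using P by (rule AE_E)
  have "cball (0::complex) 1 \<inter> space borel \<in> sets borel" by simp
  from sets_restrict_space_iff[OF this] have [measurable]: "N \<in> sets borel"
    using N(3) unfolding sets by blast
  have "AE z in \<mu>. z \<in> cball 0 1 - N"
    using N(2,3) by (intro AE_I[of _ _ N]) (auto simp: space)
  then have "AE z in distr \<mu> borel (\<lambda>z. z). z \<in> cball 0 1 - N"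
    by (subst AE_distr_iff[OF id]) auto
  then show ?thesis by eventually_elim (use N(1) space in auto)
qed

section \<open>The inequality for the density of the reverse Carleson measure\<close>

theorem theorem1p5:
  fixes \<mu> :: "complex measure"
    and b :: "complex \<Rightarrow> complex"
    and H :: "(complex \<Rightarrow> complex) set"
    and ip :: "(complex \<Rightarrow> complex) \<Rightarrow> (complex \<Rightarrow> complex) \<Rightarrow> complex"
    and h :: "complex \<Rightarrow> real"
  assumes "finite_borel_measure_on_closed_disk \<mu>"
    and "b \<in> Hinf_unit_ball"
    and "admissible \<mu> b"
    and "h = ac_deriv circle_measure (restrict_space \<mu> unit_circle)"
    and "de_Branges_Rovnyak b H ip"
    and "reverse_Carleson \<mu> H ip"
  shows "\<exists>C>0. AE \<zeta> in circle_measure.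
           1 - (norm (nt_ext b \<zeta>))\<^sup>2 \<le> C * (1 - (norm (nt_ext b \<zeta>))\<^sup>2)\<^sup>2 * h \<zeta>"
proof -
  obtain C where C: "0 < C" "\<And>f. f \<in> admissible_part \<mu> H \<Longrightarrow> ennreal (hnorm ip f) \<le> ennreal C * L2_norm \<mu> f"
    using assms(6) by (auto simp: reverse_Carleson_def)
  have sets_\<mu>: "sets \<mu> = sets (restrict_space borel (cball 0 1))" and "finite_measure \<mu>"
    using assms(1) by (auto simp: finite_borel_measure_on_closed_disk_def)
  interpret \<mu>: finite_measure \<mu> by fact
  have space_\<mu>: "space \<mu> = cball 0 1"
    using sets_\<mu> by (auto simp: space_restrict_space dest: sets_eq_imp_space_eq)
  have \<mu>_meas: "f \<in> measurable \<mu> N" if "f \<in> measurable borel N" for f :: "complex \<Rightarrow> 'b" and N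
    using measurable_restrict_space1[OF that] by (subst measurable_cong_sets[OF sets_\<mu> refl])
  have hol: "b holomorphic_on ball 0 1" and nb: "\<And>z. norm z < 1 \<Longrightarrow> norm (b z) \<le> 1"
    using assms(2) by (auto simp: Hinf_unit_ball_def)

  \<comment> \<open>\<open>nt_ext b\<close> need not be Borel measurable; the radial limit \<open>B\<close> is, and agrees with it almost everywhere.\<close>
  define \<beta> where "\<beta> z = (if z \<in> unit_disk then b z else 0)" for z
  define B where "B z = (if z \<in> unit_disk then b z else lim (\<lambda>n. \<beta> (of_real (1 - gap n) * z)))" for z
  have \<beta>_meas [measurable]: "\<beta> \<in> borel_measurable borel"
    unfolding \<beta>_def[abs_def]
    by (rule borel_measurable_continuous_on_if) (auto intro: holomorphic_on_imp_continuous_on hol)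
  have B_meas [measurable]: "B \<in> borel_measurable borel"
  proof -
    have "B = (\<lambda>z. if z \<in> unit_disk then \<beta> z else lim (\<lambda>n. \<beta> (of_real (1 - gap n) * z)))"
      by (auto simp: fun_eq_iff B_def \<beta>_def)
    also have "\<dots> \<in> borel_measurable borel"
    proof -
      have [measurable]: "(unit_disk :: complex set) \<in> sets borel" by simp
      show ?thesis by measurable
    qed
    finally show ?thesis .
  qed
  have \<beta>1: "norm (\<beta> z) \<le> 1" for z using nb by (simp add: \<beta>_def)
  have \<beta>lim: "nt_limit \<beta> \<zeta> L" if "nt_limit b \<zeta> L" for \<zeta> L
    using that by (rule nt_limit_cong[rotated]) (simp add: \<beta>_def)
  \<comment> \<open>The path with parameter 0 is the radial sequence that defines
    \<open>B\<close>.\<close>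
  have B_lim: "B \<zeta> = L" if "norm \<zeta> = 1" "nt_limit b \<zeta> L" for \<zeta> L
    using nt_limit_along_curve[OF \<beta>lim[OF that(2)] that(1), of 0] that(1)
    by (auto simp: B_def intro: limI)
  have B_ext: "nt_ext b \<zeta> = B \<zeta> \<and> nt_limit \<beta> \<zeta> (B \<zeta>) \<and> norm (B \<zeta>) \<le> 1"
    if n: "norm \<zeta> = 1" and ex: "\<exists>L. nt_limit b \<zeta> L" for \<zeta>
  proof -
    obtain L where L: "nt_limit b \<zeta> L" using ex by blast
    show ?thesis
      unfolding B_lim[OF n L] using nt_ext_eq[OF n L] \<beta>lim[OF L] norm_nt_limit_le[OF n L nb]
      by simp
  qed
  have AE_\<mu>: "AE z in \<mu>. norm z \<le> 1 \<and> nt_ext b z = B z \<and> norm (B z) \<le> 1 \<and> (norm z = 1 \<longrightarrow> nt_limit \<beta> z (B z))"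
    using assms(3)[unfolded admissible_def, THEN conjunct2] AE_space
  proof eventually_elim
    case (elim z)
    then show ?case
      using B_ext[of z] nb by (cases "norm z < 1") (auto simp: space_\<mu> B_def nt_ext_def)
  qed
  have "AE \<zeta> in circle_measure. \<zeta> \<in> unit_circle"
    by (rule AE_I2) (simp add: circle_measure_def space_restrict_space)
  with Fatou_nt_limit[OF assms(2)]
  have AE_c: "AE \<zeta> in circle_measure. nt_ext b \<zeta> = B \<zeta> \<and> nt_limit \<beta> \<zeta> (B \<zeta>)"
    by eventually_elim (use B_ext in auto)

  \<comment> \<open>\<open>M\<close> is \<mu> moved to the Borel sets of the plane and multiplied by
    the squared reverse Carleson constant, as \<open>integral_inequality_closed\<close>
    expects.\<close>
  define M where "M = density (distr \<mu> borel (\<lambda>z. z)) (\<lambda>_. ennreal (C\<^sup>2))"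
  have int_M: "(\<integral>\<^sup>+z. f z \<partial>M) = ennreal (C\<^sup>2) * (\<integral>\<^sup>+z. f z \<partial>\<mu>)"
    if [measurable]: "f \<in> borel_measurable borel" for f
  proof -
    have "(\<lambda>z. z) \<in> measurable \<mu> borel" by (rule \<mu>_meas) simp
    then show ?thesis
      unfolding M_def by (simp add: nn_integral_density nn_integral_distr nn_integral_cmult \<mu>_meas)
  qed
  have key: "(\<integral>\<^sup>+\<theta>. indicator {0..<2*pi} \<theta> * (indicator K (cis \<theta>) * ennreal (1 - (norm (B (cis \<theta>)))\<^sup>2)) \<partial>lborel)
    \<le> (\<integral>\<^sup>+z. ennreal (128 * pi) * (indicator (K \<inter> sphere 0 1) z * ennreal ((1 - (norm (B z))\<^sup>2)\<^sup>2)) \<partial>M)"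
    if K: "closed K" for K
  proof (rule integral_inequality_closed[OF \<beta>_meas K \<beta>1 _ _ B_meas])
    show "sets M = sets borel" by (simp add: M_def)
    have "emeasure M (space M) = ennreal (C\<^sup>2) * emeasure \<mu> (space \<mu>)"
      using int_M[of "\<lambda>_. 1"] by simp
    then show "finite_measure M"
      using \<mu>.emeasure_finite[of "space \<mu>"]
      by (intro finite_measureI) (simp add: ennreal_mult_eq_top_iff)
    have "AE z in distr \<mu> borel (\<lambda>z. z). norm z \<le> 1 \<and> norm (B z) \<le> 1 \<and> (norm z = 1 \<longrightarrow> nt_limit \<beta> z (B z))"
      by (rule AE_distr_borelI[OF sets_\<mu>]) (use AE_\<mu> in \<open>auto elim!: eventually_mono\<close>)
    then show "AE z in M. norm z \<le> 1 \<and> norm (B z) \<le> 1 \<and> (norm z = 1 \<longrightarrow> nt_limit \<beta> z (B z))"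
      unfolding M_def by (subst AE_density) (auto elim!: eventually_mono)
    show "AE \<theta> in lborel. \<theta> \<in> {0..<2*pi} \<longrightarrow> nt_limit \<beta> (cis \<theta>) (B (cis \<theta>))"
      using AE_c by (intro AE_circle_measureD) (auto elim!: eventually_mono)
    fix r \<theta> :: real assume r: "0 < r" "r < 1"
    define w where "w = of_real r * cis \<theta>"
    have nw: "norm w = r" using r by (simp add: w_def norm_mult)
    have r2: "0 < 1 - r\<^sup>2" using r by (simp add: power_less_one_iff)
    \<comment> \<open>Multiplication by 1 - r^2 cancels the denominator of the squared kernel norm;
      on the other side it produces the numerator of \<open>poisson\<close>.\<close>
    have "ennreal (1 - (norm (\<beta> w))\<^sup>2) = ennreal (1 - r\<^sup>2) * ennreal ((1 - (norm (b w))\<^sup>2) / (1 - (norm w)\<^sup>2))"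
      using r r2 nw by (subst ennreal_mult'[symmetric]) (auto simp: \<beta>_def)
    also have "\<dots> \<le> ennreal (1 - r\<^sup>2) * (ennreal (C\<^sup>2) *
        (\<integral>\<^sup>+z. ennreal ((norm ((1 - cnj (b w) * nt_ext b z) / (1 - cnj w * z)))\<^sup>2) \<partial>\<mu>))"
      using nw r
      by (intro mult_left_mono reverse_Carleson_kernel[OF assms(1,2,3,5) C]) auto
    also have "(\<integral>\<^sup>+z. ennreal ((norm ((1 - cnj (b w) * nt_ext b z) / (1 - cnj w * z)))\<^sup>2) \<partial>\<mu>)
        = (\<integral>\<^sup>+z. ennreal ((norm ((1 - cnj (\<beta> w) * B z) / (1 - cnj w * z)))\<^sup>2) \<partial>\<mu>)"
      using AE_\<mu> by (intro nn_integral_cong_AE, eventually_elim) (use nw r in \<open>simp add: \<beta>_def\<close>)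
    also have "ennreal (1 - r\<^sup>2) * (ennreal (C\<^sup>2) * \<dots>)
        = ennreal (C\<^sup>2) * (\<integral>\<^sup>+z. ennreal (1 - r\<^sup>2) * ennreal ((norm ((1 - cnj (\<beta> w) * B z) / (1 - cnj w * z)))\<^sup>2) \<partial>\<mu>)"
    proof (subst nn_integral_cmult)
      show "(\<lambda>z. ennreal ((norm ((1 - cnj (\<beta> w) * B z) / (1 - cnj w * z)))\<^sup>2)) \<in> borel_measurable \<mu>"
        by (rule \<mu>_meas) measurable
    qed (simp add: mult.left_commute)
    also have "\<dots> = ennreal (C\<^sup>2) * (\<integral>\<^sup>+z. ennreal (test_kernel \<beta> r (cis \<theta>) (B z) z) \<partial>\<mu>)"
      using r2
      by (simp add: ennreal_mult'[symmetric] test_kernel_def poisson_def w_def norm_divide power_divide mult.commute)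
    also have "\<dots> = (\<integral>\<^sup>+z. ennreal (test_kernel \<beta> r (cis \<theta>) (B z) z) \<partial>M)"
      by (rule int_M[symmetric]) measurable
    finally show "ennreal (1 - (norm (\<beta> (of_real r * cis \<theta>)))\<^sup>2) \<le> (\<integral>\<^sup>+z. ennreal (test_kernel \<beta> r (cis \<theta>) (B z) z) \<partial>M)"
      by (simp add: w_def)
  qed

  define \<nu> where "\<nu> = restrict_space \<mu> unit_circle"
  define F where "F z = 1 - (norm (B z))\<^sup>2" for z
  \<comment> \<open>The factor 128 pi comes from the Poisson averages and the factor
    \<open>C\<^sup>2\<close> from \<open>M\<close>.\<close>
  define c where "c = 128 * pi * C\<^sup>2"
  have c: "0 < c" using C(1) by (simp add: c_def)
  have F_meas [measurable]: "F \<in> borel_measurable borel" unfolding F_def[abs_def] by measurable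
  have circle_\<mu>: "unit_circle \<inter> space \<mu> \<in> sets \<mu>"
  proof -
    have "cball (0::complex) 1 \<inter> space borel \<in> sets borel" by simp
    moreover have "unit_circle \<inter> cball (0::complex) 1 \<in> sets borel" by (intro sets.Int borel_closed) auto
    ultimately show ?thesis unfolding sets_\<mu> space_\<mu> by (subst sets_restrict_space_iff) auto
  qed
  have sets_\<nu>: "sets \<nu> = sets circle_measure" unfolding \<nu>_def by (rule sets_restrict_circle[OF assms(1)])
  have idc: "(\<lambda>z. z) \<in> measurable circle_measure borel"
    by (subst measurable_cong_sets[OF sets_circle_measure refl]) (intro measurable_restrict_space1, simp)
  have F_c: "F \<in> borel_measurable circle_measure"
    using measurable_compose[OF idc F_meas] by simp
  have fin_c: "finite_measure circle_measure"
    by (intro finite_measureI) (simp add: emeasure_circle_measure_space)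
  have closed_le: "(\<integral>\<^sup>+\<zeta>. indicator K \<zeta> * ennreal (F \<zeta>) \<partial>circle_measure) \<le> (\<integral>\<^sup>+\<zeta>. indicator K \<zeta> * ennreal (c * (F \<zeta>)\<^sup>2) \<partial>\<nu>)"
    if K: "closed K" for K
  proof -
    have [measurable]: "K \<in> sets borel" "(unit_circle :: complex set) \<in> sets borel" using K by simp_all
    have "(\<integral>\<^sup>+\<zeta>. indicator K \<zeta> * ennreal (F \<zeta>) \<partial>circle_measure)
      = (\<integral>\<^sup>+\<theta>. indicator {0..<2*pi} \<theta> * (indicator K (cis \<theta>) * ennreal (F (cis \<theta>))) \<partial>lborel) / ennreal (2 * pi)"
      by (rule nn_integral_circle_measure) measurable
    \<comment> \<open>The normalisation of \<open>circle_measure\<close> is dropped, as 2 pi >=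
      1.\<close>
    also have "\<dots> \<le> (\<integral>\<^sup>+\<theta>. indicator {0..<2*pi} \<theta> * (indicator K (cis \<theta>) * ennreal (F (cis \<theta>))) \<partial>lborel)"
    proof (rule divide_le_posI_ennreal)
      have "ennreal 1 \<le> ennreal (2 * pi)" using pi_gt3 by (intro ennreal_leI) linarith
      then have "1 \<le> ennreal (2 * pi)" by (simp only: ennreal_1)
      then show "x \<le> ennreal (2 * pi) * x" for x using mult_right_mono[of 1 _ x] by simp
    qed simp
    also have "\<dots> \<le> (\<integral>\<^sup>+z. ennreal (128 * pi) * (indicator (K \<inter> sphere 0 1) z * ennreal ((F z)\<^sup>2)) \<partial>M)"
      unfolding F_def by (rule key[OF K])
    also have "\<dots> = ennreal (C\<^sup>2) * (\<integral>\<^sup>+z. ennreal (128 * pi) * (indicator (K \<inter> sphere 0 1) z * ennreal ((F z)\<^sup>2)) \<partial>\<mu>)"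
      by (rule int_M) measurable
    also have "\<dots> = (\<integral>\<^sup>+z. ennreal (C\<^sup>2) * (ennreal (128 * pi) * (indicator (K \<inter> sphere 0 1) z * ennreal ((F z)\<^sup>2))) \<partial>\<mu>)"
      by (rule nn_integral_cmult[symmetric], rule \<mu>_meas) measurable
    also have "\<dots> = (\<integral>\<^sup>+z. indicator K z * ennreal (c * (F z)\<^sup>2) * indicator unit_circle z \<partial>\<mu>)"
      by (intro nn_integral_cong)
        (auto simp: c_def indicator_def ennreal_mult''[symmetric] mult_ac split: if_splits simp del: ennreal_numeral)
    also have "\<dots> = (\<integral>\<^sup>+\<zeta>. indicator K \<zeta> * ennreal (c * (F \<zeta>)\<^sup>2) \<partial>\<nu>)"
      unfolding \<nu>_def by (rule nn_integral_restrict_space[symmetric, OF circle_\<mu>])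
    finally show ?thesis .
  qed
  have "AE \<zeta> in circle_measure. F \<zeta> \<le> c * (F \<zeta>)\<^sup>2 * ac_deriv circle_measure \<nu> \<zeta>"
  proof (rule AE_le_ac_deriv[OF fin_c _ sets_\<nu> F_c])
    show "finite_measure \<nu>"
    proof -
      have "unit_circle \<inter> space \<mu> = unit_circle" unfolding space_\<mu> by auto
      then show ?thesis
        unfolding \<nu>_def using circle_\<mu> by (intro finite_measure_restrict_space \<open>finite_measure \<mu>\<close>) simp
    qed
    show "F x \<le> 1" for x by (simp add: F_def)
    fix A assume A: "A \<in> sets circle_measure"
    have "A \<in> sets borel"
    proof -
      have "(unit_circle :: complex set) \<inter> space borel \<in> sets borel" by simp
      from sets_restrict_space_iff[OF this] show ?thesis
        using A unfolding sets_circle_measure by blast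
    qed
    then show "(\<integral>\<^sup>+\<zeta>. indicator A \<zeta> * ennreal (F \<zeta>) \<partial>circle_measure) \<le> (\<integral>\<^sup>+\<zeta>. indicator A \<zeta> * ennreal (c * (F \<zeta>)\<^sup>2) \<partial>\<nu>)"
    proof (rule nn_integral_le_if_le_closed[OF idc _ _ closed_le, rotated -1])
      show "(\<lambda>\<zeta>. ennreal (F \<zeta>)) \<in> borel_measurable circle_measure" using F_c by measurable
      have "(\<integral>\<^sup>+\<zeta>. ennreal (F \<zeta>) \<partial>circle_measure) \<le> (\<integral>\<^sup>+\<zeta>. 1 \<partial>circle_measure)"
        by (intro nn_integral_mono) (simp add: F_def ennreal_le_1)
      also have "\<dots> < \<infinity>" by (simp add: emeasure_circle_measure_space)
      finally show "(\<integral>\<^sup>+\<zeta>. ennreal (F \<zeta>) \<partial>circle_measure) < \<infinity>" .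
    qed
  qed (use c in auto)
  \<comment> \<open>By Fatou's theorem \<open>B\<close> agrees with \<open>nt_ext b\<close> almost
    everywhere on the circle.\<close>
  then have "AE \<zeta> in circle_measure. 1 - (norm (nt_ext b \<zeta>))\<^sup>2 \<le> c * (1 - (norm (nt_ext b \<zeta>))\<^sup>2)\<^sup>2 * h \<zeta>"
    using AE_c by eventually_elim (simp add: F_def assms(4) \<nu>_def)
  with c show ?thesis by blast
qed

end
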